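(* Let $\Bbbk$ be a field and let $A$ be an associative unital $\Bbbk$-algebra of finite dimension $n\geq 3$. Then $$\operatorname{Frobdim}(A)\leq (n-1)^2.$$
   Context: A nearly Frobenius coproduct on an associative unital $\Bbbk$-algebra $A$ is a homomorphism of $A$-bimodules $\Delta:A\to A\otimes_{\Bbbk} A$, where $A\otimes_{\Bbbk} A$ has the bimodule structure $a\cdot(b\otimes c)\cdot d=ab\otimes cd$. The Frobenius space $\mathscr{E}_A$ is the $\Bbbk$-vector space of all nearly Frobenius coproducts on $A$, and the Frobenius dimension is $\operatorname{Frobdim}(A)=\dim_{\Bbbk}\mathscr{E}_A$. *)

theory Defs
  imports "HOL-Algebra.AbelCoset" "Jordan_Normal_Form.Missing_VectorSpace"
begin

text \<open>
  The locale \<open>algebra\<close> of the library requires a commutative ring; here the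
  multiplication of the algebra need not commute.
\<close>

locale unital_algebra = vectorspace K A + A?: ring A
  for K (structure) and A (structure) +
  assumes smult_mult_left:
      "\<lbrakk>c \<in> carrier K; x \<in> carrier A; y \<in> carrier A\<rbrakk>
        \<Longrightarrow> (c \<odot>\<^bsub>A\<^esub> x) \<otimes>\<^bsub>A\<^esub> y = c \<odot>\<^bsub>A\<^esub> (x \<otimes>\<^bsub>A\<^esub> y)"
    and smult_mult_right:
      "\<lbrakk>c \<in> carrier K; x \<in> carrier A; y \<in> carrier A\<rbrakk>
        \<Longrightarrow> x \<otimes>\<^bsub>A\<^esub> (c \<odot>\<^bsub>A\<^esub> y) = c \<odot>\<^bsub>A\<^esub> (x \<otimes>\<^bsub>A\<^esub> y)"

text \<open>
  Module records extend ring records, so the constructions below have to fill the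
  fields \<open>mult\<close> and \<open>one\<close>. These carry no meaning and are set to zero.
\<close>

definition free_module :: "('k, 'r) ring_scheme \<Rightarrow> 'x set \<Rightarrow> ('k, 'x \<Rightarrow> 'k) module" where
  "free_module K S =
     (ring.func_space K S)\<lparr>carrier := {f \<in> S \<rightarrow>\<^sub>E carrier K. finite {x \<in> S. f x \<noteq> \<zero>\<^bsub>K\<^esub>}}\<rparr>"

definition free_gen :: "('k, 'r) ring_scheme \<Rightarrow> 'x set \<Rightarrow> 'x \<Rightarrow> 'x \<Rightarrow> 'k" where
  "free_gen K S x = (\<lambda>y\<in>S. if y = x then \<one>\<^bsub>K\<^esub> else \<zero>\<^bsub>K\<^esub>)"

definition quotient_module ::
    "('k, 'a, 'm) module_scheme \<Rightarrow> 'a set \<Rightarrow> ('k, 'a set) module" where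
  "quotient_module M N =
     \<lparr>carrier = a_rcosets\<^bsub>M\<^esub> N,
      mult = (\<lambda>X Y. N),
      one = N,
      zero = N,
      add = (\<lambda>X Y. X <+>\<^bsub>M\<^esub> Y),
      smult = (\<lambda>c X. \<Union>x\<in>X. N +>\<^bsub>M\<^esub> (c \<odot>\<^bsub>M\<^esub> x))\<rparr>"

text \<open>
  The tensor product of \<open>M\<close> and \<open>N\<close> over \<open>K\<close> is the free module on
  \<open>carrier M \<times> carrier N\<close> modulo the span of the bilinearity relations.
\<close>

abbreviation tensor_free ::
    "('k, 'r) ring_scheme \<Rightarrow> ('k, 'a, 'm) module_scheme \<Rightarrow> ('k, 'b, 'n) module_scheme
      \<Rightarrow> ('k, 'a \<times> 'b \<Rightarrow> 'k) module" where
  "tensor_free K M N \<equiv> free_module K (carrier M \<times> carrier N)"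

abbreviation tensor_gen ::
    "('k, 'r) ring_scheme \<Rightarrow> ('k, 'a, 'm) module_scheme \<Rightarrow> ('k, 'b, 'n) module_scheme
      \<Rightarrow> 'a \<Rightarrow> 'b \<Rightarrow> 'a \<times> 'b \<Rightarrow> 'k" where
  "tensor_gen K M N x y \<equiv> free_gen K (carrier M \<times> carrier N) (x, y)"

definition tensor_relations ::
    "('k, 'r) ring_scheme \<Rightarrow> ('k, 'a, 'm) module_scheme \<Rightarrow> ('k, 'b, 'n) module_scheme
      \<Rightarrow> ('a \<times> 'b \<Rightarrow> 'k) set" where
  "tensor_relations K M N =
     (let F = tensor_free K M N; e = tensor_gen K M N in
        {e (x \<oplus>\<^bsub>M\<^esub> x') y \<ominus>\<^bsub>F\<^esub> (e x y \<oplus>\<^bsub>F\<^esub> e x' y) | x x' y.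
           x \<in> carrier M \<and> x' \<in> carrier M \<and> y \<in> carrier N}
      \<union> {e x (y \<oplus>\<^bsub>N\<^esub> y') \<ominus>\<^bsub>F\<^esub> (e x y \<oplus>\<^bsub>F\<^esub> e x y') | x y y'.
           x \<in> carrier M \<and> y \<in> carrier N \<and> y' \<in> carrier N}
      \<union> {e (c \<odot>\<^bsub>M\<^esub> x) y \<ominus>\<^bsub>F\<^esub> c \<odot>\<^bsub>F\<^esub> e x y | c x y.
           c \<in> carrier K \<and> x \<in> carrier M \<and> y \<in> carrier N}
      \<union> {e x (c \<odot>\<^bsub>N\<^esub> y) \<ominus>\<^bsub>F\<^esub> c \<odot>\<^bsub>F\<^esub> e x y | c x y.
           c \<in> carrier K \<and> x \<in> carrier M \<and> y \<in> carrier N})"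

definition tensor_null ::
    "('k, 'r) ring_scheme \<Rightarrow> ('k, 'a, 'm) module_scheme \<Rightarrow> ('k, 'b, 'n) module_scheme
      \<Rightarrow> ('a \<times> 'b \<Rightarrow> 'k) set" where
  "tensor_null K M N =
     LinearCombinations.module.span K (tensor_free K M N) (tensor_relations K M N)"

definition tensor_product ::
    "('k, 'r) ring_scheme \<Rightarrow> ('k, 'a, 'm) module_scheme \<Rightarrow> ('k, 'b, 'n) module_scheme
      \<Rightarrow> ('k, ('a \<times> 'b \<Rightarrow> 'k) set) module" where
  "tensor_product K M N = quotient_module (tensor_free K M N) (tensor_null K M N)"

definition pure_tensor ::
    "('k, 'r) ring_scheme \<Rightarrow> ('k, 'a, 'm) module_scheme \<Rightarrow> ('k, 'b, 'n) module_scheme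
      \<Rightarrow> 'a \<Rightarrow> 'b \<Rightarrow> ('a \<times> 'b \<Rightarrow> 'k) set" where
  "pure_tensor K M N x y =
     tensor_null K M N +>\<^bsub>tensor_free K M N\<^esub> tensor_gen K M N x y"

text \<open>The linear map from the free module on \<open>S\<close> to \<open>T\<close> with values \<open>h p\<close> on the generators.\<close>

definition linear_extension ::
    "('k, 'r) ring_scheme \<Rightarrow> ('k, 'c, 't) module_scheme \<Rightarrow> 'x set \<Rightarrow> ('x \<Rightarrow> 'c)
      \<Rightarrow> ('x \<Rightarrow> 'k) \<Rightarrow> 'c" where
  "linear_extension K T S h u = (\<Oplus>\<^bsub>T\<^esub>p\<in>{p \<in> S. u p \<noteq> \<zero>\<^bsub>K\<^esub>}. u p \<odot>\<^bsub>T\<^esub> h p)"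

text \<open>
  For linear maps \<open>f\<close> and \<open>g\<close>, the endomorphism \<open>f \<otimes> g\<close> of the tensor product. A class \<open>t\<close>
  is a set of formal linear combinations, and the linear extension takes the same value on
  all of them; see \<open>tensor_lift\<close> below.
\<close>

definition tensor_map ::
    "('k, 'r) ring_scheme \<Rightarrow> ('k, 'a, 'm) module_scheme \<Rightarrow> ('k, 'b, 'n) module_scheme
      \<Rightarrow> ('a \<Rightarrow> 'a) \<Rightarrow> ('b \<Rightarrow> 'b) \<Rightarrow> ('a \<times> 'b \<Rightarrow> 'k) set \<Rightarrow> ('a \<times> 'b \<Rightarrow> 'k) set" where
  "tensor_map K M N f g t =
     the_elem (linear_extension K (tensor_product K M N) (carrier M \<times> carrier N)
       (\<lambda>(x, y). pure_tensor K M N (f x) (g y)) ` t)"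

definition left_act ::
    "('k, 'r) ring_scheme \<Rightarrow> ('k, 'a, 'm) module_scheme
      \<Rightarrow> 'a \<Rightarrow> ('a \<times> 'a \<Rightarrow> 'k) set \<Rightarrow> ('a \<times> 'a \<Rightarrow> 'k) set" where
  "left_act K A a t = tensor_map K A A (\<lambda>b. a \<otimes>\<^bsub>A\<^esub> b) (\<lambda>c. c) t"

definition right_act ::
    "('k, 'r) ring_scheme \<Rightarrow> ('k, 'a, 'm) module_scheme
      \<Rightarrow> ('a \<times> 'a \<Rightarrow> 'k) set \<Rightarrow> 'a \<Rightarrow> ('a \<times> 'a \<Rightarrow> 'k) set" where
  "right_act K A t d = tensor_map K A A (\<lambda>b. b) (\<lambda>c. c \<otimes>\<^bsub>A\<^esub> d) t"

text \<open>
  Coproducts are extensional functions, so that two of them are equal as soon as they agree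
  on the carrier of \<open>A\<close>.
\<close>

definition nearly_frobenius_coproducts ::
    "('k, 'r) ring_scheme \<Rightarrow> ('k, 'a, 'm) module_scheme
      \<Rightarrow> ('a \<Rightarrow> ('a \<times> 'a \<Rightarrow> 'k) set) set" where
  "nearly_frobenius_coproducts K A =
     {\<Delta> \<in> extensional (carrier A) \<inter> module_hom K A (tensor_product K A A).
        (\<forall>a\<in>carrier A. \<forall>x\<in>carrier A. \<Delta> (a \<otimes>\<^bsub>A\<^esub> x) = left_act K A a (\<Delta> x)) \<and>
        (\<forall>x\<in>carrier A. \<forall>d\<in>carrier A. \<Delta> (x \<otimes>\<^bsub>A\<^esub> d) = right_act K A (\<Delta> x) d)}"

definition frobenius_space ::
    "('k, 'r) ring_scheme \<Rightarrow> ('k, 'a, 'm) module_scheme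
      \<Rightarrow> ('k, 'a \<Rightarrow> ('a \<times> 'a \<Rightarrow> 'k) set) module" where
  "frobenius_space K A =
     (let T = tensor_product K A A; z = (\<lambda>a\<in>carrier A. \<zero>\<^bsub>T\<^esub>) in
        \<lparr>carrier = nearly_frobenius_coproducts K A,
         mult = (\<lambda>\<Delta> \<Gamma>. z),
         one = z,
         zero = z,
         add = (\<lambda>\<Delta> \<Gamma>. \<lambda>a\<in>carrier A. \<Delta> a \<oplus>\<^bsub>T\<^esub> \<Gamma> a),
         smult = (\<lambda>c \<Delta>. \<lambda>a\<in>carrier A. c \<odot>\<^bsub>T\<^esub> \<Delta> a)\<rparr>)"

definition Frobdim :: "('k, 'r) ring_scheme \<Rightarrow> ('k, 'a, 'm) module_scheme \<Rightarrow> nat" where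
  "Frobdim K A = vectorspace.dim K (frobenius_space K A)"

text \<open>
  The rest of the theory shows that the constructions are well defined: the tensor product
  is a module with the universal property of bilinear maps (\<open>tensor_lift\<close>), the two actions
  satisfy \<open>a \<cdot> (b \<otimes> c) = ab \<otimes> c\<close> and \<open>(b \<otimes> c) \<cdot> d = b \<otimes> cd\<close>, and the Frobenius space is a
  vector space over \<open>K\<close>.
\<close>


lemma (in cring) free_submodule:
  "submodule R {f \<in> S \<rightarrow>\<^sub>E carrier R. finite {x \<in> S. f x \<noteq> \<zero>}} (func_space S)"
    (is "submodule R ?N _")
proof -
  have add: "v \<oplus>\<^bsub>func_space S\<^esub> w \<in> ?N" if v: "v \<in> ?N" and w: "w \<in> ?N" for v w
  proof -
    have "{x \<in> S. v x \<oplus> w x \<noteq> \<zero>} \<subseteq> {x \<in> S. v x \<noteq> \<zero>} \<union> {x \<in> S. w x \<noteq> \<zero>}"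
      by auto
    then have "finite {x \<in> S. v x \<oplus> w x \<noteq> \<zero>}"
      using v w by (metis (no_types, lifting) finite_Un finite_subset mem_Collect_eq)
    then show ?thesis
      using v w by (auto simp: func_space_def PiE_mem2 cong: conj_cong)
  qed
  have smult: "c \<odot>\<^bsub>func_space S\<^esub> v \<in> ?N" if c: "c \<in> carrier R" and v: "v \<in> ?N" for c v
  proof -
    have "{x \<in> S. c \<otimes> v x \<noteq> \<zero>} \<subseteq> {x \<in> S. v x \<noteq> \<zero>}" using c by auto
    then have "finite {x \<in> S. c \<otimes> v x \<noteq> \<zero>}"
      using v by (metis (no_types, lifting) finite_subset mem_Collect_eq)
    then show ?thesis
      using c v by (auto simp: func_space_def PiE_mem2 cong: conj_cong)
  qed
  show ?thesis
    by (rule submodule.intro, rule func_space_is_module)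
      (use add smult in \<open>auto simp: func_space_def cong: conj_cong\<close>)
qed

lemma free_module_is_module: "cring K \<Longrightarrow> module K (free_module K S)"
  unfolding free_module_def
  by (intro module.submodule_is_module cring.func_space_is_module cring.free_submodule)

lemma free_gen_closed:
  assumes "cring K" "x \<in> S"
  shows "free_gen K S x \<in> carrier (free_module K S)"
proof -
  interpret cring K by fact
  have "{y \<in> S. (if y = x then \<one>\<^bsub>K\<^esub> else \<zero>\<^bsub>K\<^esub>) \<noteq> \<zero>\<^bsub>K\<^esub>} \<subseteq> {x}" by auto
  from finite_subset[OF this] have "finite {y \<in> S. free_gen K S x y \<noteq> \<zero>\<^bsub>K\<^esub>}"
    unfolding free_gen_def by (auto cong: conj_cong)
  then show ?thesis by (auto simp: free_module_def free_gen_def)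
qed

lemma (in submodule) is_abelian_subgroup: "abelian_subgroup N M"
proof -
  interpret module R M by (rule module)
  have "\<ominus>\<^bsub>M\<^esub> x \<in> N" if x: "x \<in> N" for x
  proof -
    have "(\<ominus>\<^bsub>R\<^esub> \<one>\<^bsub>R\<^esub>) \<odot>\<^bsub>M\<^esub> x \<in> N"
      by (rule LinearCombinations.submodule.smult_closed[OF submodule_axioms _ x]) simp
    then show ?thesis using smult_minus_1[of x] x subset by (metis subsetD)
  qed
  moreover have "N \<noteq> {}"
    using LinearCombinations.submodule.zero_closed[OF submodule_axioms] by blast
  ultimately have "subgroup N (add_monoid M)"
    by (intro M.add.subgroupI subset) simp_all
  then show ?thesis
    by (intro abelian_subgroupI3 additive_subgroupI M.abelian_group_axioms)
qed

lemma quotient_smult: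
  assumes sub: "submodule R N M" and c: "c \<in> carrier R" and x: "x \<in> carrier M"
  shows "c \<odot>\<^bsub>quotient_module M N\<^esub> (N +>\<^bsub>M\<^esub> x) = N +>\<^bsub>M\<^esub> (c \<odot>\<^bsub>M\<^esub> x)"
proof -
  have M: "module R M" and NM: "N \<subseteq> carrier M"
    using sub by (auto simp: submodule_def)
  have ag: "abelian_group M" using M by (rule module.axioms)
  have grp: "subgroup N (add_monoid M)"
    using submodule.is_abelian_subgroup[OF sub]
    by (intro additive_subgroup.a_subgroup abelian_subgroup.axioms)
  have cx: "c \<odot>\<^bsub>M\<^esub> x \<in> carrier M" by (rule module.smult_closed[OF M c x])
  have "N +>\<^bsub>M\<^esub> (c \<odot>\<^bsub>M\<^esub> y) = N +>\<^bsub>M\<^esub> (c \<odot>\<^bsub>M\<^esub> x)" if "y \<in> N +>\<^bsub>M\<^esub> x" for y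
  proof -
    from that obtain n where n: "n \<in> N" "y = n \<oplus>\<^bsub>M\<^esub> x" unfolding a_r_coset_def' by blast
    have "c \<odot>\<^bsub>M\<^esub> y = c \<odot>\<^bsub>M\<^esub> n \<oplus>\<^bsub>M\<^esub> c \<odot>\<^bsub>M\<^esub> x"
      unfolding n(2) using module.smult_r_distr[OF M c _ x] n(1) NM by blast
    moreover have "c \<odot>\<^bsub>M\<^esub> n \<in> N"
      by (rule LinearCombinations.submodule.smult_closed[OF sub c n(1)])
    ultimately have "c \<odot>\<^bsub>M\<^esub> y \<in> N +>\<^bsub>M\<^esub> (c \<odot>\<^bsub>M\<^esub> x)" unfolding a_r_coset_def' by blast
    then show ?thesis using abelian_group.a_repr_independence[OF ag _ cx grp] by simp
  qed
  moreover have "x \<in> N +>\<^bsub>M\<^esub> x"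
    using abelian_subgroup.a_rcos_self[OF submodule.is_abelian_subgroup[OF sub] x] .
  ultimately have "(\<Union>y\<in>N +>\<^bsub>M\<^esub> x. N +>\<^bsub>M\<^esub> (c \<odot>\<^bsub>M\<^esub> y)) = N +>\<^bsub>M\<^esub> (c \<odot>\<^bsub>M\<^esub> x)"
    by blast
  then show ?thesis by (simp add: quotient_module_def)
qed

lemma quotient_add:
  assumes "submodule R N M" "x \<in> carrier M" "y \<in> carrier M"
  shows "(N +>\<^bsub>M\<^esub> x) \<oplus>\<^bsub>quotient_module M N\<^esub> (N +>\<^bsub>M\<^esub> y) = N +>\<^bsub>M\<^esub> (x \<oplus>\<^bsub>M\<^esub> y)"
  using abelian_subgroup.a_rcos_sum[OF submodule.is_abelian_subgroup[OF assms(1)] assms(2,3)]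
  by (simp add: quotient_module_def)

lemma quotient_zero:
  assumes sub: "submodule R N M"
  shows "\<zero>\<^bsub>quotient_module M N\<^esub> = N +>\<^bsub>M\<^esub> \<zero>\<^bsub>M\<^esub>"
proof -
  have "abelian_group M" "N \<subseteq> carrier M"
    using sub by (auto simp: submodule_def module_def)
  then show ?thesis by (simp add: quotient_module_def abelian_group.a_coset_add_zero)
qed

lemma quotient_carrier:
  "carrier (quotient_module M N) = (\<lambda>x. N +>\<^bsub>M\<^esub> x) ` carrier M"
  by (auto simp: quotient_module_def A_RCOSETS_def')

lemma quotient_is_module:
  assumes sub: "submodule R N M"
  shows "module R (quotient_module M N)"
proof -
  interpret submodule R N M by fact
  interpret module R M by (rule module)
  note q = quotient_smult[OF sub] quotient_add[OF sub] quotient_zero[OF sub]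
  show ?thesis
  proof (rule module_criteria)
    show "\<forall>v\<in>carrier (quotient_module M N). \<exists>neg_v\<in>carrier (quotient_module M N).
      v \<oplus>\<^bsub>quotient_module M N\<^esub> neg_v = \<zero>\<^bsub>quotient_module M N\<^esub>"
    proof
      fix v assume "v \<in> carrier (quotient_module M N)"
      then obtain x where x: "x \<in> carrier M" "v = N +>\<^bsub>M\<^esub> x" by (auto simp: quotient_carrier)
      then show "\<exists>neg_v\<in>carrier (quotient_module M N).
          v \<oplus>\<^bsub>quotient_module M N\<^esub> neg_v = \<zero>\<^bsub>quotient_module M N\<^esub>"
        by (intro bexI[of _ "N +>\<^bsub>M\<^esub> (\<ominus>\<^bsub>M\<^esub> x)"]) (auto simp: quotient_carrier q M.r_neg)
    qed
  next
    show "\<forall>v w. v \<in> carrier (quotient_module M N) \<and> w \<in> carrier (quotient_module M N) \<longrightarrow>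
      v \<oplus>\<^bsub>quotient_module M N\<^esub> w = w \<oplus>\<^bsub>quotient_module M N\<^esub> v"
    proof (intro allI impI)
      fix v w assume "v \<in> carrier (quotient_module M N) \<and> w \<in> carrier (quotient_module M N)"
      then obtain x y where "x \<in> carrier M" "v = N +>\<^bsub>M\<^esub> x" "y \<in> carrier M" "w = N +>\<^bsub>M\<^esub> y"
        by (auto simp: quotient_carrier)
      then show "v \<oplus>\<^bsub>quotient_module M N\<^esub> w = w \<oplus>\<^bsub>quotient_module M N\<^esub> v"
        using M.a_comm[of x y] by (simp add: q)
    qed
  qed (auto simp: quotient_carrier q R.is_cring smult_l_distr smult_r_distr smult_assoc1 M.a_assoc)
qed

lemma quotient_eq_zero:
  assumes sub: "submodule R N M" and "x \<in> N"
  shows "N +>\<^bsub>M\<^esub> x = \<zero>\<^bsub>quotient_module M N\<^esub>"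
proof -
  interpret submodule R N M by fact
  interpret module R M by (rule module)
  interpret abelian_subgroup N M by (rule is_abelian_subgroup)
  show ?thesis using assms a_subset a_subgroup
    using a_coset_join2[of x N] by (simp add: quotient_module_def subset_iff)
qed

lemma free_module_simps:
  assumes "cring K"
  shows "carrier (free_module K S) = {f \<in> S \<rightarrow>\<^sub>E carrier K. finite {x \<in> S. f x \<noteq> \<zero>\<^bsub>K\<^esub>}}"
    "u \<oplus>\<^bsub>free_module K S\<^esub> v = (\<lambda>x\<in>S. u x \<oplus>\<^bsub>K\<^esub> v x)"
    "c \<odot>\<^bsub>free_module K S\<^esub> u = (\<lambda>x\<in>S. c \<otimes>\<^bsub>K\<^esub> u x)"
proof -
  interpret cring K by fact
  show "carrier (free_module K S) = {f \<in> S \<rightarrow>\<^sub>E carrier K. finite {x \<in> S. f x \<noteq> \<zero>\<^bsub>K\<^esub>}}"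
    "u \<oplus>\<^bsub>free_module K S\<^esub> v = (\<lambda>x\<in>S. u x \<oplus>\<^bsub>K\<^esub> v x)"
    "c \<odot>\<^bsub>free_module K S\<^esub> u = (\<lambda>x\<in>S. c \<otimes>\<^bsub>K\<^esub> u x)"
    by (auto simp: free_module_def func_space_def)
qed

context module begin

lemma linear_extension_superset:
  assumes "h \<in> S \<rightarrow> carrier M" "u \<in> S \<rightarrow> carrier R" "finite B" "B \<subseteq> S" "{p \<in> S. u p \<noteq> \<zero>\<^bsub>R\<^esub>} \<subseteq> B"
  shows "linear_extension R M S h u = (\<Oplus>\<^bsub>M\<^esub>p\<in>B. u p \<odot>\<^bsub>M\<^esub> h p)"
  unfolding linear_extension_def
  by (rule M.add.finprod_mono_neutral_cong_left) (use assms in \<open>auto simp: Pi_def\<close>)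

lemma linear_extension_hom:
  assumes h: "h \<in> S \<rightarrow> carrier M"
  shows "linear_extension R M S h \<in> module_hom R (free_module R S) M"
proof -
  note fs [simp] = free_module_simps[OF R.is_cring]
  have 1: "linear_extension R M S h u \<in> carrier M" if "u \<in> carrier (free_module R S)" for u
    unfolding linear_extension_def using that h by (intro M.finsum_closed) (auto simp: Pi_def)
  have 2: "linear_extension R M S h (u \<oplus>\<^bsub>free_module R S\<^esub> v) =
      linear_extension R M S h u \<oplus>\<^bsub>M\<^esub> linear_extension R M S h v"
    if u: "u \<in> carrier (free_module R S)" and v: "v \<in> carrier (free_module R S)" for u v
  proof -
    define B where "B = {p \<in> S. u p \<noteq> \<zero>\<^bsub>R\<^esub>} \<union> {p \<in> S. v p \<noteq> \<zero>\<^bsub>R\<^esub>}"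
    have B: "finite B" "B \<subseteq> S" using u v by (auto simp: B_def)
    have uv: "u \<in> S \<rightarrow> carrier R" "v \<in> S \<rightarrow> carrier R" using u v by auto
    have "linear_extension R M S h (u \<oplus>\<^bsub>free_module R S\<^esub> v) =
        (\<Oplus>\<^bsub>M\<^esub>p\<in>B. (u \<oplus>\<^bsub>free_module R S\<^esub> v) p \<odot>\<^bsub>M\<^esub> h p)"
      using uv by (intro linear_extension_superset h B) (auto simp: B_def Pi_def)
    also have "\<dots> = (\<Oplus>\<^bsub>M\<^esub>p\<in>B. u p \<odot>\<^bsub>M\<^esub> h p \<oplus>\<^bsub>M\<^esub> v p \<odot>\<^bsub>M\<^esub> h p)"
      using uv h B by (intro M.finsum_cong') (auto simp: Pi_def smult_l_distr subset_iff)
    also have "\<dots> = (\<Oplus>\<^bsub>M\<^esub>p\<in>B. u p \<odot>\<^bsub>M\<^esub> h p) \<oplus>\<^bsub>M\<^esub> (\<Oplus>\<^bsub>M\<^esub>p\<in>B. v p \<odot>\<^bsub>M\<^esub> h p)"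
      using uv h B by (intro M.finsum_addf) (auto simp: Pi_def subset_iff)
    also have "(\<Oplus>\<^bsub>M\<^esub>p\<in>B. u p \<odot>\<^bsub>M\<^esub> h p) = linear_extension R M S h u"
      using uv by (intro linear_extension_superset[symmetric] h B) (auto simp: B_def)
    also have "(\<Oplus>\<^bsub>M\<^esub>p\<in>B. v p \<odot>\<^bsub>M\<^esub> h p) = linear_extension R M S h v"
      using uv by (intro linear_extension_superset[symmetric] h B) (auto simp: B_def)
    finally show ?thesis .
  qed
  have 3: "linear_extension R M S h (c \<odot>\<^bsub>free_module R S\<^esub> u) = c \<odot>\<^bsub>M\<^esub> linear_extension R M S h u"
    if c: "c \<in> carrier R" and u: "u \<in> carrier (free_module R S)" for c u
  proof -
    define B where "B = {p \<in> S. u p \<noteq> \<zero>\<^bsub>R\<^esub>}"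
    have B: "finite B" "B \<subseteq> S" using u by (auto simp: B_def)
    have uR: "u \<in> S \<rightarrow> carrier R" using u by auto
    have "linear_extension R M S h (c \<odot>\<^bsub>free_module R S\<^esub> u) =
        (\<Oplus>\<^bsub>M\<^esub>p\<in>B. (c \<odot>\<^bsub>free_module R S\<^esub> u) p \<odot>\<^bsub>M\<^esub> h p)"
      using uR c by (intro linear_extension_superset h B) (auto simp: B_def Pi_def)
    also have "\<dots> = (\<Oplus>\<^bsub>M\<^esub>p\<in>B. c \<odot>\<^bsub>M\<^esub> (u p \<odot>\<^bsub>M\<^esub> h p))"
      using uR h B c by (intro M.finsum_cong') (auto simp: Pi_def smult_assoc1 subset_iff)
    also have "\<dots> = c \<odot>\<^bsub>M\<^esub> (\<Oplus>\<^bsub>M\<^esub>p\<in>B. u p \<odot>\<^bsub>M\<^esub> h p)"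
      using uR h B c by (intro finsum_smult[symmetric]) (auto simp: Pi_def subset_iff)
    finally show ?thesis by (simp add: linear_extension_def B_def)
  qed
  show ?thesis using 1 2 3 by (auto simp only: module_hom_def)
qed

lemma linear_extension_gen:
  assumes h: "h \<in> S \<rightarrow> carrier M" and p: "p \<in> S"
  shows "linear_extension R M S h (free_gen R S p) = h p"
proof -
  have "linear_extension R M S h (free_gen R S p) = (\<Oplus>\<^bsub>M\<^esub>q\<in>{p}. free_gen R S p q \<odot>\<^bsub>M\<^esub> h q)"
    using p by (intro linear_extension_superset h) (auto simp: free_gen_def)
  also have "\<dots> = h p" using p h by (auto simp: free_gen_def Pi_def)
  finally show ?thesis .
qed

end

locale two_modules = M: module R M + N: module R N for R and M (structure) and N (structure)
begin

abbreviation "F \<equiv> tensor_free R M N"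
abbreviation "T \<equiv> tensor_product R M N"
abbreviation "e \<equiv> tensor_gen R M N"
abbreviation "pure \<equiv> pure_tensor R M N"

sublocale F: module R F
  by (rule free_module_is_module) (rule M.R.is_cring)

lemma e_closed [simp, intro]: "x \<in> carrier M \<Longrightarrow> y \<in> carrier N \<Longrightarrow> e x y \<in> carrier F"
  by (rule free_gen_closed[OF M.R.is_cring]) simp

lemma relations_closed: "tensor_relations R M N \<subseteq> carrier F"
  unfolding tensor_relations_def Let_def
  by (auto intro!: F.M.minus_closed F.M.a_closed F.smult_closed e_closed)

lemma null_submodule: "submodule R (tensor_null R M N) F"
  unfolding tensor_null_def by (rule F.span_is_submodule[OF relations_closed])

sublocale T: module R T
  unfolding tensor_product_def by (rule quotient_is_module[OF null_submodule])

lemma pure_closed [simp, intro]: "x \<in> carrier M \<Longrightarrow> y \<in> carrier N \<Longrightarrow> pure x y \<in> carrier T"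
  by (auto simp: pure_tensor_def tensor_product_def quotient_carrier)

lemma relations_null: "tensor_relations R M N \<subseteq> tensor_null R M N"
  unfolding tensor_null_def by (rule F.in_own_span[OF relations_closed])

lemma class_eqI:
  assumes "u \<in> carrier F" "v \<in> carrier F" "u \<ominus>\<^bsub>F\<^esub> v \<in> tensor_null R M N"
  shows "tensor_null R M N +>\<^bsub>F\<^esub> u = tensor_null R M N +>\<^bsub>F\<^esub> v"
proof -
  interpret N': abelian_subgroup "tensor_null R M N" F
    by (rule submodule.is_abelian_subgroup[OF null_submodule])
  have "(u \<ominus>\<^bsub>F\<^esub> v) \<oplus>\<^bsub>F\<^esub> v = u" using assms(1,2) by (simp add: a_minus_def F.M.a_assoc F.M.l_neg)
  then have "u \<in> tensor_null R M N +>\<^bsub>F\<^esub> v" using assms(3) by (force simp: a_r_coset_def')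
  then show ?thesis using F.M.a_repr_independence[OF _ assms(2) N'.a_subgroup] by simp
qed

lemma pure_add_left:
  assumes "x \<in> carrier M" "x' \<in> carrier M" "y \<in> carrier N"
  shows "pure (x \<oplus>\<^bsub>M\<^esub> x') y = pure x y \<oplus>\<^bsub>T\<^esub> pure x' y"
proof -
  have "e (x \<oplus>\<^bsub>M\<^esub> x') y \<ominus>\<^bsub>F\<^esub> (e x y \<oplus>\<^bsub>F\<^esub> e x' y) \<in> tensor_null R M N"
    unfolding tensor_relations_def Let_def
    by (rule subsetD[OF relations_null[unfolded tensor_relations_def Let_def]], rule UnI1, rule UnI1, rule UnI1)
      (intro CollectI exI conjI, rule refl, (rule assms)+)
  then have "tensor_null R M N +>\<^bsub>F\<^esub> e (x \<oplus>\<^bsub>M\<^esub> x') y = tensor_null R M N +>\<^bsub>F\<^esub> (e x y \<oplus>\<^bsub>F\<^esub> e x' y)"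
    by (rule class_eqI[rotated 2]) (intro F.M.a_closed F.smult_closed M.M.a_closed N.M.a_closed
      M.smult_closed N.smult_closed e_closed assms)+
  then show ?thesis
    unfolding pure_tensor_def tensor_product_def
    by (simp only: quotient_add[OF null_submodule] e_closed assms)
qed

lemma pure_add_right:
  assumes "x \<in> carrier M" "y \<in> carrier N" "y' \<in> carrier N"
  shows "pure x (y \<oplus>\<^bsub>N\<^esub> y') = pure x y \<oplus>\<^bsub>T\<^esub> pure x y'"
proof -
  have "e x (y \<oplus>\<^bsub>N\<^esub> y') \<ominus>\<^bsub>F\<^esub> (e x y \<oplus>\<^bsub>F\<^esub> e x y') \<in> tensor_null R M N"
    unfolding tensor_relations_def Let_def
    by (rule subsetD[OF relations_null[unfolded tensor_relations_def Let_def]], rule UnI1, rule UnI1, rule UnI2)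
      (intro CollectI exI conjI, rule refl, (rule assms)+)
  then have "tensor_null R M N +>\<^bsub>F\<^esub> e x (y \<oplus>\<^bsub>N\<^esub> y') = tensor_null R M N +>\<^bsub>F\<^esub> (e x y \<oplus>\<^bsub>F\<^esub> e x y')"
    by (rule class_eqI[rotated 2]) (intro F.M.a_closed F.smult_closed M.M.a_closed N.M.a_closed
      M.smult_closed N.smult_closed e_closed assms)+
  then show ?thesis
    unfolding pure_tensor_def tensor_product_def
    by (simp only: quotient_add[OF null_submodule] e_closed assms)
qed

lemma pure_smult_left:
  assumes "c \<in> carrier R" "x \<in> carrier M" "y \<in> carrier N"
  shows "pure (c \<odot>\<^bsub>M\<^esub> x) y = c \<odot>\<^bsub>T\<^esub> pure x y"
proof -
  have "e (c \<odot>\<^bsub>M\<^esub> x) y \<ominus>\<^bsub>F\<^esub> c \<odot>\<^bsub>F\<^esub> e x y \<in> tensor_null R M N"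
    unfolding tensor_relations_def Let_def
    by (rule subsetD[OF relations_null[unfolded tensor_relations_def Let_def]], rule UnI1, rule UnI2)
      (intro CollectI exI conjI, rule refl, (rule assms)+)
  then have "tensor_null R M N +>\<^bsub>F\<^esub> e (c \<odot>\<^bsub>M\<^esub> x) y = tensor_null R M N +>\<^bsub>F\<^esub> (c \<odot>\<^bsub>F\<^esub> e x y)"
    by (rule class_eqI[rotated 2]) (intro F.M.a_closed F.smult_closed M.M.a_closed N.M.a_closed
      M.smult_closed N.smult_closed e_closed assms)+
  then show ?thesis
    unfolding pure_tensor_def tensor_product_def
    by (simp only: quotient_smult[OF null_submodule] e_closed assms)
qed

lemma pure_smult_right:
  assumes "c \<in> carrier R" "x \<in> carrier M" "y \<in> carrier N"
  shows "pure x (c \<odot>\<^bsub>N\<^esub> y) = c \<odot>\<^bsub>T\<^esub> pure x y"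
proof -
  have "e x (c \<odot>\<^bsub>N\<^esub> y) \<ominus>\<^bsub>F\<^esub> c \<odot>\<^bsub>F\<^esub> e x y \<in> tensor_null R M N"
    unfolding tensor_relations_def Let_def
    by (rule subsetD[OF relations_null[unfolded tensor_relations_def Let_def]], rule UnI2)
      (intro CollectI exI conjI, rule refl, (rule assms)+)
  then have "tensor_null R M N +>\<^bsub>F\<^esub> e x (c \<odot>\<^bsub>N\<^esub> y) = tensor_null R M N +>\<^bsub>F\<^esub> (c \<odot>\<^bsub>F\<^esub> e x y)"
    by (rule class_eqI[rotated 2]) (intro F.M.a_closed F.smult_closed M.M.a_closed N.M.a_closed
      M.smult_closed N.smult_closed e_closed assms)+
  then show ?thesis
    unfolding pure_tensor_def tensor_product_def
    by (simp only: quotient_smult[OF null_submodule] e_closed assms)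
qed

lemma class_in_carrier: "u \<in> carrier F \<Longrightarrow> tensor_null R M N +>\<^bsub>F\<^esub> u \<in> carrier T"
  by (auto simp: tensor_product_def quotient_carrier)

lemma carrier_T_E:
  assumes "t \<in> carrier T"
  obtains u where "u \<in> carrier F" "t = tensor_null R M N +>\<^bsub>F\<^esub> u"
  using assms by (auto simp: tensor_product_def quotient_carrier)

lemma tensor_lift:
  assumes P: "module R P"
    and h: "h \<in> carrier M \<times> carrier N \<rightarrow> carrier P"
    and add_left: "\<And>x x' y. x \<in> carrier M \<Longrightarrow> x' \<in> carrier M \<Longrightarrow> y \<in> carrier N
        \<Longrightarrow> h (x \<oplus>\<^bsub>M\<^esub> x', y) = h (x, y) \<oplus>\<^bsub>P\<^esub> h (x', y)"
    and add_right: "\<And>x y y'. x \<in> carrier M \<Longrightarrow> y \<in> carrier N \<Longrightarrow> y' \<in> carrier N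
        \<Longrightarrow> h (x, y \<oplus>\<^bsub>N\<^esub> y') = h (x, y) \<oplus>\<^bsub>P\<^esub> h (x, y')"
    and smult_left: "\<And>c x y. c \<in> carrier R \<Longrightarrow> x \<in> carrier M \<Longrightarrow> y \<in> carrier N
        \<Longrightarrow> h (c \<odot>\<^bsub>M\<^esub> x, y) = c \<odot>\<^bsub>P\<^esub> h (x, y)"
    and smult_right: "\<And>c x y. c \<in> carrier R \<Longrightarrow> x \<in> carrier M \<Longrightarrow> y \<in> carrier N
        \<Longrightarrow> h (x, c \<odot>\<^bsub>N\<^esub> y) = c \<odot>\<^bsub>P\<^esub> h (x, y)"
  defines "\<Phi> \<equiv> \<lambda>t. the_elem (linear_extension R P (carrier M \<times> carrier N) h ` t)"
  shows "\<Phi> \<in> module_hom R T P"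
    and "\<And>x y. x \<in> carrier M \<Longrightarrow> y \<in> carrier N \<Longrightarrow> \<Phi> (pure x y) = h (x, y)"
proof -
  interpret P: module R P by fact
  let ?L = "linear_extension R P (carrier M \<times> carrier N) h"
  interpret L: mod_hom R F P ?L
    by (intro mod_hom.intro F.module_axioms P P.linear_extension_hom h mod_hom_axioms.intro)
  have gen: "?L (e x y) = h (x, y)" if "x \<in> carrier M" "y \<in> carrier N" for x y
    using that by (intro P.linear_extension_gen h) auto
  have hc: "h (x, y) \<in> carrier P" if "x \<in> carrier M" "y \<in> carrier N" for x y
    using h that by auto
  have "u \<in> L.ker" if "u \<in> tensor_relations R M N" for u
  proof -
    have "?L u = \<zero>\<^bsub>P\<^esub>"
      using that unfolding tensor_relations_def Let_def
    proof (elim UnE CollectE exE conjE, goal_cases)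
      case (1 x x' y)
      then show ?case by (simp add: gen hc add_left P.M.r_neg a_minus_def)
    next
      case (2 x y y')
      then show ?case by (simp add: gen hc add_right P.M.r_neg a_minus_def)
    next
      case (3 c x y)
      then show ?case by (simp add: gen hc smult_left P.M.r_neg a_minus_def)
    next
      case (4 c x y)
      then show ?case by (simp add: gen hc smult_right P.M.r_neg a_minus_def)
    qed
    then show ?thesis using that relations_closed unfolding L.ker_def by blast
  qed
  then have "tensor_relations R M N \<subseteq> L.ker" by blast
  then have ker: "tensor_null R M N \<subseteq> L.ker"
    unfolding tensor_null_def by (intro F.span_is_subset L.ker_is_submodule)
  have \<Phi>: "\<Phi> (tensor_null R M N +>\<^bsub>F\<^esub> u) = ?L u" if u: "u \<in> carrier F" for u
  proof -
    interpret N': abelian_subgroup "tensor_null R M N" F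
      by (rule submodule.is_abelian_subgroup[OF null_submodule])
    have "?L v = ?L u" if "v \<in> tensor_null R M N +>\<^bsub>F\<^esub> u" for v
    proof -
      from that obtain w where w: "w \<in> tensor_null R M N" "v = w \<oplus>\<^bsub>F\<^esub> u"
        unfolding a_r_coset_def' by blast
      then have "w \<in> carrier F" "?L w = \<zero>\<^bsub>P\<^esub>" using ker unfolding L.ker_def by blast+
      then show ?thesis using u w(2) by simp
    qed
    moreover have "u \<in> tensor_null R M N +>\<^bsub>F\<^esub> u" using u by (rule N'.a_rcos_self)
    ultimately have "?L ` (tensor_null R M N +>\<^bsub>F\<^esub> u) = {?L u}" by blast
    then show ?thesis by (simp add: \<Phi>_def)
  qed
  show "\<Phi> (pure x y) = h (x, y)" if "x \<in> carrier M" "y \<in> carrier N" for x y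
    unfolding pure_tensor_def using that by (simp add: \<Phi> gen)
  show "\<Phi> \<in> module_hom R T P"
    unfolding module_hom_def
  proof (safe, goal_cases)
    case (1 t) then show ?case by (elim carrier_T_E) (simp add: \<Phi>)
  next
    case (2 s t) then show ?case
      by (elim carrier_T_E) (simp add: \<Phi> tensor_product_def quotient_add[OF null_submodule])
  next
    case (3 c t) then show ?case
      by (elim carrier_T_E) (simp add: \<Phi> tensor_product_def quotient_smult[OF null_submodule])
  qed
qed

lemma
  assumes f: "f \<in> module_hom R M M" and g: "g \<in> module_hom R N N"
  shows tensor_map_linear: "tensor_map R M N f g \<in> module_hom R T T"
    and tensor_map_pure: "\<And>x y. x \<in> carrier M \<Longrightarrow> y \<in> carrier N
        \<Longrightarrow> tensor_map R M N f g (pure x y) = pure (f x) (g y)"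
proof -
  let ?h = "\<lambda>(x, y). pure (f x) (g y)"
  note hom = module_hom_closed[OF f, THEN funcset_mem] module_hom_closed[OF g, THEN funcset_mem]
    module_hom_add[OF f] module_hom_add[OF g] module_hom_smult[OF f] module_hom_smult[OF g]
  note lift = tensor_lift[OF T.module_axioms, of ?h]
  show "tensor_map R M N f g \<in> module_hom R T T"
    unfolding tensor_map_def by (rule lift)
      (auto simp: hom pure_add_left pure_add_right pure_smult_left pure_smult_right)
  show "tensor_map R M N f g (pure x y) = pure (f x) (g y)"
    if "x \<in> carrier M" "y \<in> carrier N" for x y
    unfolding tensor_map_def using that by (subst lift(2))
      (auto simp: hom pure_add_left pure_add_right pure_smult_left pure_smult_right)
qed

end

context unital_algebra
begin

sublocale AA: two_modules K A A
  by (intro two_modules.intro) (rule module_axioms)+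

lemma left_act_linear: "a \<in> carrier A \<Longrightarrow> left_act K A a \<in> module_hom K AA.T AA.T"
  unfolding left_act_def
  by (rule AA.tensor_map_linear) (auto simp: module_hom_def A.r_distr smult_mult_right)

lemma right_act_linear:
  "d \<in> carrier A \<Longrightarrow> (\<lambda>t. right_act K A t d) \<in> module_hom K AA.T AA.T"
  unfolding right_act_def
  by (rule AA.tensor_map_linear) (auto simp: module_hom_def A.l_distr smult_mult_left)

lemma left_act_pure:
  "\<lbrakk>a \<in> carrier A; b \<in> carrier A; c \<in> carrier A\<rbrakk>
    \<Longrightarrow> left_act K A a (AA.pure b c) = AA.pure (a \<otimes>\<^bsub>A\<^esub> b) c"
  unfolding left_act_def
  by (rule AA.tensor_map_pure) (auto simp: module_hom_def A.r_distr smult_mult_right)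

lemma right_act_pure:
  "\<lbrakk>b \<in> carrier A; c \<in> carrier A; d \<in> carrier A\<rbrakk>
    \<Longrightarrow> right_act K A (AA.pure b c) d = AA.pure b (c \<otimes>\<^bsub>A\<^esub> d)"
  unfolding right_act_def
  by (rule AA.tensor_map_pure) (auto simp: module_hom_def A.l_distr smult_mult_left)

lemma coproduct_add:
  assumes D: "D \<in> nearly_frobenius_coproducts K A" and E: "E \<in> nearly_frobenius_coproducts K A"
  shows "(\<lambda>a\<in>carrier A. D a \<oplus>\<^bsub>AA.T\<^esub> E a) \<in> nearly_frobenius_coproducts K A"
proof -
  have [simp]: "D a \<in> carrier AA.T" "E a \<in> carrier AA.T" if "a \<in> carrier A" for a
    using D E that by (auto simp: nearly_frobenius_coproducts_def module_hom_def)
  show ?thesis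
    using D E
    by (auto simp: nearly_frobenius_coproducts_def module_hom_def AA.T.smult_r_distr AA.T.M.a_ac
        module_hom_add[OF left_act_linear] module_hom_add[OF right_act_linear])
qed

lemma coproduct_smult:
  assumes D: "D \<in> nearly_frobenius_coproducts K A" and k: "k \<in> carrier K"
  shows "(\<lambda>a\<in>carrier A. k \<odot>\<^bsub>AA.T\<^esub> D a) \<in> nearly_frobenius_coproducts K A"
proof -
  have [simp]: "D a \<in> carrier AA.T" if "a \<in> carrier A" for a
    using D that by (auto simp: nearly_frobenius_coproducts_def module_hom_def)
  have comm: "k \<odot>\<^bsub>AA.T\<^esub> (c \<odot>\<^bsub>AA.T\<^esub> t) = c \<odot>\<^bsub>AA.T\<^esub> (k \<odot>\<^bsub>AA.T\<^esub> t)"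
    if "c \<in> carrier K" "t \<in> carrier AA.T" for c t
    using that k by (metis AA.T.smult_assoc1 m_comm)
  show ?thesis
    using D k
    by (auto simp: nearly_frobenius_coproducts_def module_hom_def AA.T.smult_r_distr comm
        module_hom_smult[OF left_act_linear] module_hom_smult[OF right_act_linear])
qed

lemma coproduct_zero: "(\<lambda>a\<in>carrier A. \<zero>\<^bsub>AA.T\<^esub>) \<in> nearly_frobenius_coproducts K A"
proof -
  have "f \<zero>\<^bsub>AA.T\<^esub> = \<zero>\<^bsub>AA.T\<^esub>" if "f \<in> module_hom K AA.T AA.T" for f
  proof -
    have "f \<zero>\<^bsub>AA.T\<^esub> \<in> carrier AA.T" using module_hom_closed[OF that] by (rule funcset_mem) simp
    then show ?thesis using module_hom_smult[OF that, of "\<zero>\<^bsub>K\<^esub>" "\<zero>\<^bsub>AA.T\<^esub>"] by simp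
  qed
  from this[OF left_act_linear] this[OF right_act_linear] show ?thesis
    by (auto simp: nearly_frobenius_coproducts_def module_hom_def)
qed

lemma coproduct_closed:
  "D \<in> nearly_frobenius_coproducts K A \<Longrightarrow> a \<in> carrier A \<Longrightarrow> D a \<in> carrier AA.T"
  by (auto simp: nearly_frobenius_coproducts_def module_hom_def)

lemma coproduct_eqI:
  assumes "D \<in> nearly_frobenius_coproducts K A" "E \<in> extensional (carrier A)"
    "\<And>a. a \<in> carrier A \<Longrightarrow> E a = D a"
  shows "E = D"
  using assms by (intro extensionalityI[of E "carrier A"]) (auto simp: nearly_frobenius_coproducts_def)

lemma frobenius_space_vectorspace: "vectorspace K (frobenius_space K A)"
proof -
  let ?E = "frobenius_space K A"
  have carrier: "carrier ?E = nearly_frobenius_coproducts K A"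
    and zero: "\<zero>\<^bsub>?E\<^esub> = (\<lambda>a\<in>carrier A. \<zero>\<^bsub>AA.T\<^esub>)"
    and add: "\<And>D E. D \<oplus>\<^bsub>?E\<^esub> E = (\<lambda>a\<in>carrier A. D a \<oplus>\<^bsub>AA.T\<^esub> E a)"
    and smult: "\<And>c D. c \<odot>\<^bsub>?E\<^esub> D = (\<lambda>a\<in>carrier A. c \<odot>\<^bsub>AA.T\<^esub> D a)"
    by (simp_all add: frobenius_space_def Let_def)
  note cl = coproduct_closed
  have "module K ?E"
  proof (rule module_criteria, unfold carrier zero add smult, goal_cases)
    case 1 show ?case by (rule R.is_cring)
  next
    case 2 show ?case by (rule coproduct_zero)
  next
    case 3 show ?case by (simp add: coproduct_add)
  next
    case 4
    show ?case
    proof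
      fix D assume D: "D \<in> nearly_frobenius_coproducts K A"
      let ?D' = "\<lambda>a\<in>carrier A. (\<ominus>\<^bsub>K\<^esub> \<one>\<^bsub>K\<^esub>) \<odot>\<^bsub>AA.T\<^esub> D a"
      have "(\<lambda>a\<in>carrier A. D a \<oplus>\<^bsub>AA.T\<^esub> ?D' a) = (\<lambda>a\<in>carrier A. \<zero>\<^bsub>AA.T\<^esub>)"
        by (rule restrict_ext) (simp add: cl[OF D] AA.T.smult_minus_1 AA.T.M.r_neg)
      moreover have "?D' \<in> nearly_frobenius_coproducts K A" by (rule coproduct_smult[OF D]) simp
      ultimately show "\<exists>E\<in>nearly_frobenius_coproducts K A.
          (\<lambda>a\<in>carrier A. D a \<oplus>\<^bsub>AA.T\<^esub> E a) = (\<lambda>a\<in>carrier A. \<zero>\<^bsub>AA.T\<^esub>)"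
        by (rule bexI)
    qed
  next
    case 5 show ?case by (simp add: coproduct_smult)
  next
    case 6 show ?case
      by (intro allI impI restrict_ext) (simp add: cl AA.T.M.a_comm)
  next
    case 7 show ?case
      by (intro allI impI restrict_ext) (simp add: cl AA.T.M.a_assoc)
  next
    case 8 show ?case
      by (intro ballI coproduct_eqI) (simp_all add: cl)
  next
    case 9 show ?case
      by (intro allI impI restrict_ext) (simp add: cl AA.T.smult_assoc1)
  next
    case 10 show ?case
      by (intro ballI coproduct_eqI) (simp_all add: cl)
  next
    case 11 show ?case
      by (intro allI impI restrict_ext) (simp add: cl AA.T.smult_l_distr)
  next
    case 12 show ?case
      by (intro allI impI restrict_ext) (simp add: cl AA.T.smult_r_distr)
  qed
  then show ?thesis by (intro vectorspace.intro field_axioms)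
qed

end

end

theory Submission
  imports Defs
begin

text \<open>
  A coproduct \<open>\<Delta>\<close> is determined by the tensor \<open>t = \<Delta> 1\<close>, because \<open>\<Delta> a = a \<cdot> t\<close>, and the two
  bimodule conditions at \<open>1\<close> give \<open>c \<cdot> t = t \<cdot> c\<close> for all \<open>c\<close>. Such Casimir tensors meet the
  subspace \<open>1 \<otimes> A + A \<otimes> 1\<close> trivially as soon as \<open>dim A \<ge> 3\<close>, so they embed into the quotient
  \<open>(A / K1) \<otimes> (A / K1)\<close>, whose dimension is \<open>(n - 1)\<^sup>2\<close>.

  For the trivial intersection, let \<open>t = 1 \<otimes> a + u \<otimes> 1\<close> be a Casimir tensor. In the quotient,
  \<open>c \<cdot> t = t \<cdot> c\<close> becomes \<open>c \<otimes> a = u \<otimes> c\<close>. A nonzero tensor \<open>c \<otimes> a\<close> determines the line spanned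
  by \<open>c\<close>. Since \<open>A / K1\<close> contains at least two lines, some \<open>c\<close> avoids the line of \<open>u\<close>, which
  forces \<open>a\<close> and likewise \<open>u\<close> to be scalars. Then \<open>t\<close> is a multiple of \<open>1 \<otimes> 1\<close>, and this is not
  Casimir unless it is zero, because \<open>c \<otimes> 1\<close> and \<open>1 \<otimes> c\<close> are independent for \<open>c \<notin> K1\<close>.

  The formal argument uses coordinates with respect to a basis \<open>B\<close> of \<open>A\<close> with \<open>1 \<in> B\<close>
  (\<open>unital_basis_exists\<close>). A tensor becomes its \<open>B \<times> B\<close> matrix of coefficients, the quotient map
  becomes deletion of the row and the column of \<open>1\<close>, and \<open>casimir_eq_zero\<close> is the trivial
  intersection. The dimension bound then follows from \<open>linear_map.inj_dim_le\<close>.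
\<close>

section \<open>Spanning sets and dimension\<close>

lemma (in module) span_induct [consumes 2, case_names zero add smult base]:
  assumes x: "x \<in> span S" and S: "S \<subseteq> carrier M"
    and zero: "Q \<zero>\<^bsub>M\<^esub>"
    and add: "\<And>x y. \<lbrakk>x \<in> carrier M; y \<in> carrier M; Q x; Q y\<rbrakk> \<Longrightarrow> Q (x \<oplus>\<^bsub>M\<^esub> y)"
    and smult: "\<And>c x. \<lbrakk>c \<in> carrier R; x \<in> carrier M; Q x\<rbrakk> \<Longrightarrow> Q (c \<odot>\<^bsub>M\<^esub> x)"
    and base: "\<And>x. x \<in> S \<Longrightarrow> Q x"
  shows "Q x"
proof -
  have "submodule R {x \<in> carrier M. Q x} M"
    by (rule submodule.intro) (auto simp: module_axioms zero add smult)
  then have "span S \<subseteq> {x \<in> carrier M. Q x}"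
    using S base by (intro span_is_subset) auto
  then show ?thesis using x by auto
qed

lemma free_module_zero:
  assumes "cring K"
  shows "\<zero>\<^bsub>free_module K S\<^esub> = (\<lambda>x\<in>S. \<zero>\<^bsub>K\<^esub>)"
proof -
  interpret cring K by fact
  show ?thesis by (simp add: free_module_def func_space_def)
qed

text \<open>
  The induction on the support splits off one generator at a time. For finite \<open>S\<close> this bounds the
  dimension of \<open>K\<^sup>S\<close>; for infinite \<open>S\<close> it is what reduces statements about the tensor product to
  pure tensors.
\<close>

lemma free_gen_spans:
  assumes K: "cring K"
  shows "LinearCombinations.module.span K (free_module K S) (free_gen K S ` S)
    = carrier (free_module K S)"
proof -
  let ?F = "free_module K S"
  interpret cring K by fact
  interpret F: module K ?F by (rule free_module_is_module[OF K])
  note simps = free_module_simps[OF K]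
  have gens: "free_gen K S ` S \<subseteq> carrier ?F" by (intro image_subsetI free_gen_closed[OF K])
  interpret N: submodule K "F.span (free_gen K S ` S)" ?F
    by (rule F.span_is_submodule[OF gens])
  have "u \<in> F.span (free_gen K S ` S)"
    if "finite X" "u \<in> carrier ?F" "{x \<in> S. u x \<noteq> \<zero>\<^bsub>K\<^esub>} = X" for X u
    using that
  proof (induction X arbitrary: u rule: finite_induct)
    case empty
    then have "u = \<zero>\<^bsub>?F\<^esub>"
      by (auto simp: simps free_module_zero[OF K] PiE_def intro!: extensionalityI[of u S])
    then show ?case by simp
  next
    case (insert p X)
    have p: "p \<in> S" using insert.prems by blast
    have uK: "u x \<in> carrier K" if "x \<in> S" for x
      using insert.prems(1) that by (auto simp: simps)
    let ?v = "\<lambda>x\<in>S. if x = p then \<zero>\<^bsub>K\<^esub> else u x"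
    have supp: "{x \<in> S. ?v x \<noteq> \<zero>\<^bsub>K\<^esub>} = X"
      using insert.prems(2) insert.hyps(2) by (auto split: if_splits)
    have v: "?v \<in> carrier ?F"
      using supp insert.hyps(1) uK by (auto simp: simps cong: conj_cong)
    have "u = ?v \<oplus>\<^bsub>?F\<^esub> (u p \<odot>\<^bsub>?F\<^esub> free_gen K S p)"
      using insert.prems(1) uK uK[OF p]
      by (intro extensionalityI[of u S]) (auto simp: simps free_gen_def PiE_def)
    also have "\<dots> \<in> F.span (free_gen K S ` S)"
      using F.in_own_span[OF gens] p
      by (intro N.m_closed N.smult_closed insert.IH[OF v supp] uK[OF p]) auto
    finally show ?case .
  qed
  then have "carrier ?F \<subseteq> F.span (free_gen K S ` S)"
    by (auto simp: simps)
  then show ?thesis using F.span_is_subset2[OF gens] by blast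
qed

lemma
  assumes K: "field K" and S: "finite S"
  shows free_module_vectorspace: "vectorspace K (free_module K S)"
    and free_module_fin_dim: "vectorspace.fin_dim K (free_module K S)"
    and free_module_dim_le: "vectorspace.dim K (free_module K S) \<le> card S"
proof -
  have cr: "cring K" using K by (simp add: field_def domain_def)
  interpret vectorspace K "free_module K S"
    by (intro vectorspace.intro free_module_is_module cr K)
  show "vectorspace K (free_module K S)" by (rule vectorspace_axioms)
  have gens: "free_gen K S ` S \<subseteq> carrier (free_module K S)" by (intro image_subsetI free_gen_closed[OF cr])
  show fin_dim
    unfolding fin_dim_def by (intro exI[of _ "free_gen K S ` S"] conjI finite_imageI S gens free_gen_spans[OF cr])
  have "dim \<le> card (free_gen K S ` S)"
    by (intro gen_ge_dim finite_imageI S gens free_gen_spans[OF cr])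
  also have "\<dots> \<le> card S" by (rule card_image_le[OF S])
  finally show "dim \<le> card S" .
qed

lemma (in linear_map) inj_lin_indpt_image:
  assumes inj: "inj_on T (carrier V)" and S: "finite S" "S \<subseteq> carrier V" "V.module.lin_indpt S"
  shows "W.module.lin_indpt (T ` S)"
proof (rule W.module.finite_lin_indpt2)
  show "finite (T ` S)" "T ` S \<subseteq> carrier W" using S by auto
  fix a assume a: "a \<in> T ` S \<rightarrow> carrier K" and zero: "W.module.lincomb a (T ` S) = \<zero>\<^bsub>W\<^esub>"
  have aT: "a \<circ> T \<in> S \<rightarrow> carrier K" using a by auto
  have "V.module.lincomb (a \<circ> T) S = \<zero>\<^bsub>V\<^esub>"
  proof (rule inj_onD[OF inj])
    show "T (V.module.lincomb (a \<circ> T) S) = T \<zero>\<^bsub>V\<^esub>"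
      using lincomb_linear_image[OF inj S(2) a S(1)] zero by simp
    show "V.module.lincomb (a \<circ> T) S \<in> carrier V" by (rule V.module.lincomb_closed[OF S(2) aT])
  qed simp
  then have "a \<circ> T \<in> S \<rightarrow> {\<zero>\<^bsub>K\<^esub>}"
    using S aT by (intro V.not_lindepD[of S]) auto
  then show "\<forall>v\<in>T ` S. a v = \<zero>\<^bsub>K\<^esub>" by auto
qed

text \<open>
  Rank-nullity needs a finite-dimensional domain, which is part of the claim here. Instead, the
  images of independent sets are independent, so their sizes are bounded by \<open>dim W\<close>, and an
  independent set of maximal size is a finite basis.
\<close>

lemma (in linear_map) inj_dim_le:
  assumes inj: "inj_on T (carrier V)" and fd: "W.fin_dim"
  shows "V.fin_dim" "V.dim \<le> W.dim"
proof -
  let ?P = "\<lambda>S. S \<subseteq> carrier V \<and> V.module.lin_indpt S"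
  have fin_le: "card S \<le> W.dim" if "?P S" "finite S" for S
  proof -
    have "card S = card (T ` S)"
      using that inj by (intro card_image[symmetric]) (auto intro: inj_on_subset)
    also have "\<dots> \<le> W.dim"
      using that inj_lin_indpt_image[OF inj that(2)] by (intro W.li_le_dim(2)[OF fd]) auto
    finally show ?thesis .
  qed
  have bound: "finite S \<and> card S \<le> W.dim" if S: "?P S" for S
  proof -
    have "finite S"
    proof (rule ccontr)
      assume "infinite S"
      then obtain U where U: "U \<subseteq> S" "finite U" "card U = Suc W.dim"
        using infinite_arbitrarily_large by blast
      then have "?P U" using S V.module.subset_li_is_li by blast
      then have "card U \<le> W.dim" using U(2) by (rule fin_le)
      then show False using U(3) by simp
    qed
    then show ?thesis using fin_le S by blast
  qed
  have "?P {}" by (auto simp: V.module.lin_dep_def)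
  then obtain S where S: "finite S" "maximal S ?P"
    using maximal_exists[of ?P, OF bound] by blast
  then have basis: "V.basis S" by (intro V.max_li_is_basis)
  then show "V.fin_dim" using S(1) unfolding V.basis_def V.fin_dim_def by blast
  show "V.dim \<le> W.dim"
    using V.dim_basis[OF S(1) basis] bound[of S] basis unfolding V.basis_def by simp
qed

section \<open>Coordinates\<close>

locale finite_basis = vectorspace K V for K and V +
  fixes B
  assumes finite_B: "finite B" and basis_B: "basis B"
begin

definition coord where
  "coord x = (THE a. a \<in> B \<rightarrow>\<^sub>E carrier K \<and> lincomb a B = x)"

lemma B_closed: "B \<subseteq> carrier V" and span_B: "span B = carrier V"
  using basis_B by (auto simp: basis_def)

lemma coord_ex1: "x \<in> carrier V \<Longrightarrow> \<exists>!a. a \<in> B \<rightarrow>\<^sub>E carrier K \<and> lincomb a B = x"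
  using basis_criterion[OF finite_B B_closed] basis_B by blast

lemma
  assumes "x \<in> carrier V"
  shows coord_PiE: "coord x \<in> B \<rightarrow>\<^sub>E carrier K" and lincomb_coord: "lincomb (coord x) B = x"
  using theI'[OF coord_ex1[OF assms]] unfolding coord_def by blast+

lemma coord_closed [simp]: "\<lbrakk>x \<in> carrier V; b \<in> B\<rbrakk> \<Longrightarrow> coord x b \<in> carrier K"
  using coord_PiE by blast

lemma coord_eqI:
  assumes a: "a \<in> B \<rightarrow> carrier K" and x: "lincomb a B = x" and b: "b \<in> B"
  shows "coord x b = a b"
proof -
  let ?a = "restrict a B"
  have "lincomb ?a B = lincomb a B"
    using a B_closed by (intro lincomb_cong) auto
  then have a': "?a \<in> B \<rightarrow>\<^sub>E carrier K \<and> lincomb ?a B = x" using a x by auto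
  have "x \<in> carrier V" using a x B_closed by auto
  then have "coord x = ?a"
    unfolding coord_def by (intro the1_equality coord_ex1 a')
  then show ?thesis using b by simp
qed

lemma coord_add:
  assumes "x \<in> carrier V" "y \<in> carrier V" "b \<in> B"
  shows "coord (x \<oplus>\<^bsub>V\<^esub> y) b = coord x b \<oplus>\<^bsub>K\<^esub> coord y b"
  using assms lincomb_sum[OF finite_B B_closed, of "coord x" "coord y"]
  by (intro coord_eqI) (auto simp: lincomb_coord)

lemma coord_smult:
  assumes "c \<in> carrier K" "x \<in> carrier V" "b \<in> B"
  shows "coord (c \<odot>\<^bsub>V\<^esub> x) b = c \<otimes>\<^bsub>K\<^esub> coord x b"
  using assms lincomb_smult[OF B_closed, of "coord x" c]
  by (intro coord_eqI) (auto simp: lincomb_coord)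

lemma coord_basis:
  assumes "b \<in> B" "d \<in> B"
  shows "coord d b = (if b = d then \<one>\<^bsub>K\<^esub> else \<zero>\<^bsub>K\<^esub>)"
proof -
  let ?a = "\<lambda>b. if b = d then \<one>\<^bsub>K\<^esub> else \<zero>\<^bsub>K\<^esub>"
  have d: "d \<in> carrier V" using assms B_closed by blast
  have "lincomb ?a B = ?a d \<odot>\<^bsub>V\<^esub> d \<oplus>\<^bsub>V\<^esub> lincomb ?a (B - {d})"
    using assms finite_B B_closed by (intro lincomb_del2) auto
  also have "lincomb ?a (B - {d}) = \<zero>\<^bsub>V\<^esub>"
    using B_closed by (intro lincomb_zero) auto
  finally have "lincomb ?a B = d" using d by simp
  then show ?thesis using assms by (intro coord_eqI) auto
qed

end

section \<open>Tensors\<close>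

text \<open>
  This allows tensors to be treated by induction from basis tensors alone. The span absorbs
  \<open>pure x y\<close> first for \<open>x \<in> X\<close> by additivity in \<open>y\<close>, then for all \<open>x\<close>, and finally the classes of
  all formal linear combinations.
\<close>

lemma (in two_modules) pure_spans:
  assumes X: "X \<subseteq> carrier M" "M.span X = carrier M" and Y: "Y \<subseteq> carrier N" "N.span Y = carrier N"
  shows "T.span (case_prod pure ` (X \<times> Y)) = carrier T"
proof -
  let ?G = "case_prod pure ` (X \<times> Y)"
  have G: "?G \<subseteq> carrier T" using X Y by auto
  interpret S: submodule R "T.span ?G" T by (rule T.span_is_submodule[OF G])
  have left0: "pure x \<zero>\<^bsub>N\<^esub> = \<zero>\<^bsub>T\<^esub>" if "x \<in> carrier M" for x
    using pure_smult_right[of "\<zero>\<^bsub>R\<^esub>" x "\<zero>\<^bsub>N\<^esub>"] that by simp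
  have right0: "pure \<zero>\<^bsub>M\<^esub> y = \<zero>\<^bsub>T\<^esub>" if "y \<in> carrier N" for y
    using pure_smult_left[of "\<zero>\<^bsub>R\<^esub>" "\<zero>\<^bsub>M\<^esub>" y] that by simp
  have left: "pure x y \<in> T.span ?G" if x: "x \<in> X" and y: "y \<in> carrier N" for x y
  proof -
    from y have "y \<in> N.span Y" using Y by simp
    then show ?thesis using Y(1)
    proof (induction rule: N.span_induct)
      case zero show ?case using left0 x X by auto
    next
      case (add y z) then show ?case using x X by (auto simp: pure_add_right subset_iff)
    next
      case (smult c y) then show ?case using x X by (auto simp: pure_smult_right subset_iff)
    next
      case (base y) then show ?case using x T.in_own_span[OF G] by auto
    qed
  qed
  have pure: "pure x y \<in> T.span ?G" if x: "x \<in> carrier M" and y: "y \<in> carrier N" for x y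
  proof -
    from x have "x \<in> M.span X" using X by simp
    then show ?thesis using X(1)
    proof (induction rule: M.span_induct)
      case zero show ?case using right0 y by auto
    next
      case (add x z) then show ?case using y by (auto simp: pure_add_left)
    next
      case (smult c x) then show ?case using y by (auto simp: pure_smult_left)
    next
      case (base x) then show ?case using left y by auto
    qed
  qed
  have "tensor_null R M N +>\<^bsub>F\<^esub> u \<in> T.span ?G" if u: "u \<in> carrier F" for u
  proof -
    have "u \<in> F.span (free_gen R (carrier M \<times> carrier N) ` (carrier M \<times> carrier N))"
      using u free_gen_spans[OF M.R.is_cring] by blast
    moreover have "free_gen R (carrier M \<times> carrier N) ` (carrier M \<times> carrier N) \<subseteq> carrier F"
      by auto
    ultimately show ?thesis
    proof (induction rule: F.span_induct)
      case zero
      show ?case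
        using quotient_zero[OF null_submodule] S.zero_closed by (simp add: tensor_product_def)
    next
      case (add u v)
      then show ?case
        using quotient_add[OF null_submodule, of u v] S.m_closed
        by (metis tensor_product_def)
    next
      case (smult c u)
      then show ?case
        using quotient_smult[OF null_submodule, of c u] S.smult_closed
        by (metis tensor_product_def)
    next
      case (base u)
      then obtain x y where xy: "x \<in> carrier M" "y \<in> carrier N" "u = e x y" by auto
      have "tensor_null R M N +>\<^bsub>F\<^esub> u = pure x y" by (simp add: pure_tensor_def xy)
      then show ?case using pure[OF xy(1,2)] by simp
    qed
  qed
  then have "carrier T \<subseteq> T.span ?G" using carrier_T_E by blast
  then show ?thesis using T.span_is_subset2[OF G] by blast
qed

lemma (in abelian_monoid) finsum_single:
  assumes I: "finite I" "q \<in> I" and f: "f \<in> I \<rightarrow> carrier G"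
    and zero: "\<And>i. \<lbrakk>i \<in> I; i \<noteq> q\<rbrakk> \<Longrightarrow> f i = \<zero>"
  shows "(\<Oplus>i\<in>I. f i) = f q"
proof -
  have "(\<Oplus>i\<in>I. f i) = (\<Oplus>i\<in>I. if q = i then f i else \<zero>)"
    using f zero by (intro finsum_cong') (auto simp: Pi_def)
  also have "\<dots> = f q" by (rule finsum_singleton[OF I(2,1) f])
  finally show ?thesis .
qed

locale algebra_basis = unital_algebra K A + finite_basis K A B
  for K (structure) and A (structure) and B
begin

abbreviation "Mat \<equiv> free_module K (B \<times> B)"

text \<open>
  This is the map that \<open>tensor_lift\<close> associates with the bilinear map sending \<open>x\<close> and \<open>y\<close> to the
  outer product of their coordinate vectors.
\<close>

definition coeffs where
  "coeffs t = the_elem (linear_extension K Mat (carrier A \<times> carrier A)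
     (\<lambda>(x, y). \<lambda>p\<in>B \<times> B. coord x (fst p) \<otimes>\<^bsub>K\<^esub> coord y (snd p)) ` t)"

sublocale Mat: vectorspace K Mat
  by (intro free_module_vectorspace field_axioms) (simp add: finite_B)

lemma Mat_simps:
  "carrier Mat = B \<times> B \<rightarrow>\<^sub>E carrier K"
  "u \<oplus>\<^bsub>Mat\<^esub> v = (\<lambda>p\<in>B \<times> B. u p \<oplus>\<^bsub>K\<^esub> v p)"
  "c \<odot>\<^bsub>Mat\<^esub> u = (\<lambda>p\<in>B \<times> B. c \<otimes>\<^bsub>K\<^esub> u p)"
  using finite_B by (auto simp: free_module_simps[OF R.is_cring])

lemma coeffs_hom: "coeffs \<in> module_hom K AA.T Mat"
  and coeffs_pure: "\<And>x y. \<lbrakk>x \<in> carrier A; y \<in> carrier A\<rbrakk>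
    \<Longrightarrow> coeffs (AA.pure x y) = (\<lambda>p\<in>B \<times> B. coord x (fst p) \<otimes>\<^bsub>K\<^esub> coord y (snd p))"
proof -
  let ?h = "\<lambda>(x, y). \<lambda>p\<in>B \<times> B. coord x (fst p) \<otimes>\<^bsub>K\<^esub> coord y (snd p)"
  note lift = AA.tensor_lift[OF Mat.module_axioms, of ?h]
  have h: "?h \<in> carrier A \<times> carrier A \<rightarrow> carrier Mat" by (auto simp: Mat_simps split: if_splits)
  show "coeffs \<in> module_hom K AA.T Mat"
    unfolding coeffs_def
    by (rule lift(1)[OF h])
      (auto simp: Mat_simps coord_add coord_smult R.l_distr R.r_distr R.m_assoc R.m_lcomm
        intro!: restrict_ext)
  show "coeffs (AA.pure x y) = (\<lambda>p\<in>B \<times> B. coord x (fst p) \<otimes>\<^bsub>K\<^esub> coord y (snd p))"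
    if "x \<in> carrier A" "y \<in> carrier A" for x y
    unfolding coeffs_def using that
    by (subst lift(2)[OF h])
      (auto simp: Mat_simps coord_add coord_smult R.l_distr R.r_distr R.m_assoc R.m_lcomm
        intro!: restrict_ext)
qed

sublocale coeffs: linear_map K AA.T Mat coeffs
  by (intro linear_map.intro vectorspace.intro mod_hom.intro mod_hom_axioms.intro
    AA.T.module_axioms Mat.module_axioms coeffs_hom field_axioms)

lemma coeffs_closed [simp]: "\<lbrakk>t \<in> carrier AA.T; p \<in> B \<times> B\<rbrakk> \<Longrightarrow> coeffs t p \<in> carrier K"
  using coeffs.T_im[of t] by (auto simp: Mat_simps)

lemma basis_pure_spans: "AA.T.span (case_prod AA.pure ` (B \<times> B)) = carrier AA.T"
  by (intro AA.pure_spans B_closed span_B)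

lemma tensor_induct [consumes 1, case_names zero add smult base]:
  assumes t: "t \<in> carrier AA.T" and zero: "Q \<zero>\<^bsub>AA.T\<^esub>"
    and add: "\<And>s t. \<lbrakk>s \<in> carrier AA.T; t \<in> carrier AA.T; Q s; Q t\<rbrakk> \<Longrightarrow> Q (s \<oplus>\<^bsub>AA.T\<^esub> t)"
    and smult: "\<And>c t. \<lbrakk>c \<in> carrier K; t \<in> carrier AA.T; Q t\<rbrakk> \<Longrightarrow> Q (c \<odot>\<^bsub>AA.T\<^esub> t)"
    and base: "\<And>b d. \<lbrakk>b \<in> B; d \<in> B\<rbrakk> \<Longrightarrow> Q (AA.pure b d)"
  shows "Q t"
proof -
  have "case_prod AA.pure ` (B \<times> B) \<subseteq> carrier AA.T" using B_closed by auto
  with t[folded basis_pure_spans] show ?thesis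
    by (induction rule: AA.T.span_induct) (auto intro: assms)
qed

text \<open>
  The matrix determines the tensor: the linear map sending the \<open>(b, d)\<close> unit matrix to
  \<open>b \<otimes> d\<close> is a left inverse of \<open>coeffs\<close>, since the two are inverse to each other on basis tensors.
\<close>

lemma coeffs_eq_zero:
  assumes t: "t \<in> carrier AA.T" and zero: "\<And>b d. \<lbrakk>b \<in> B; d \<in> B\<rbrakk> \<Longrightarrow> coeffs t (b, d) = \<zero>\<^bsub>K\<^esub>"
  shows "t = \<zero>\<^bsub>AA.T\<^esub>"
proof -
  let ?L = "linear_extension K AA.T (B \<times> B) (case_prod AA.pure)"
  have gens: "case_prod AA.pure \<in> B \<times> B \<rightarrow> carrier AA.T" using B_closed by auto
  interpret L: linear_map K Mat AA.T ?L
    by (intro linear_map.intro vectorspace.intro mod_hom.intro mod_hom_axioms.intro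
      AA.T.module_axioms Mat.module_axioms field_axioms AA.T.linear_extension_hom gens)
  have "?L (coeffs s) = s" if "s \<in> carrier AA.T" for s
    using that
  proof (induction rule: tensor_induct)
    case (base b d)
    have "coeffs (AA.pure b d) = free_gen K (B \<times> B) (b, d)"
      using base B_closed
      by (auto simp: coeffs_pure free_gen_def coord_basis subset_iff intro!: restrict_ext)
    then show ?case using AA.T.linear_extension_gen[OF gens, of "(b, d)"] base by simp
  qed simp_all
  moreover have "coeffs t = \<zero>\<^bsub>Mat\<^esub>"
  proof -
    have "\<zero>\<^bsub>Mat\<^esub> = \<zero>\<^bsub>K\<^esub> \<odot>\<^bsub>Mat\<^esub> coeffs t" using t by simp
    also have "\<dots> = coeffs t"
      using t zero coeffs.T_im[OF t]
      by (intro extensionalityI[of _ "B \<times> B"]) (auto simp: Mat_simps PiE_def)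
    finally show ?thesis by simp
  qed
  ultimately show ?thesis using t L.f0_is_0 by metis
qed


text \<open>
  With \<open>\<phi>\<close> an entry of the matrix of \<open>c \<cdot> t\<close> or \<open>t \<cdot> c\<close>, this expresses both actions through the
  matrix of \<open>t\<close>. The functional is a plain function because \<open>K\<close> is not a module over itself as a
  record.
\<close>

lemma linear_functional_expansion:
  assumes closed: "\<And>t. t \<in> carrier AA.T \<Longrightarrow> \<phi> t \<in> carrier K"
    and add: "\<And>s t. \<lbrakk>s \<in> carrier AA.T; t \<in> carrier AA.T\<rbrakk> \<Longrightarrow> \<phi> (s \<oplus>\<^bsub>AA.T\<^esub> t) = \<phi> s \<oplus>\<^bsub>K\<^esub> \<phi> t"
    and smult: "\<And>c t. \<lbrakk>c \<in> carrier K; t \<in> carrier AA.T\<rbrakk> \<Longrightarrow> \<phi> (c \<odot>\<^bsub>AA.T\<^esub> t) = c \<otimes>\<^bsub>K\<^esub> \<phi> t"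
    and t: "t \<in> carrier AA.T"
  shows "\<phi> t = (\<Oplus>\<^bsub>K\<^esub>p\<in>B \<times> B. coeffs t p \<otimes>\<^bsub>K\<^esub> \<phi> (case_prod AA.pure p))"
  using t
proof (induction rule: tensor_induct)
  have gen: "\<phi> (AA.pure b d) \<in> carrier K" if "b \<in> B" "d \<in> B" for b d
    using that B_closed by (intro closed) auto
  note [simp] = finite_B
  {
    case zero
    have "\<phi> \<zero>\<^bsub>AA.T\<^esub> = \<zero>\<^bsub>K\<^esub>"
      using smult[of "\<zero>\<^bsub>K\<^esub>" "\<zero>\<^bsub>AA.T\<^esub>"] closed by simp
    then show ?case
      using gen by (auto simp: free_module_zero[OF R.is_cring] intro!: R.add.finprod_one_eqI[symmetric])
  next
    case (add s t)
    have "(\<Oplus>\<^bsub>K\<^esub>p\<in>B \<times> B. coeffs (s \<oplus>\<^bsub>AA.T\<^esub> t) p \<otimes>\<^bsub>K\<^esub> \<phi> (case_prod AA.pure p))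
        = (\<Oplus>\<^bsub>K\<^esub>p\<in>B \<times> B. coeffs s p \<otimes>\<^bsub>K\<^esub> \<phi> (case_prod AA.pure p)
            \<oplus>\<^bsub>K\<^esub> coeffs t p \<otimes>\<^bsub>K\<^esub> \<phi> (case_prod AA.pure p))"
      using add(1,2) gen by (intro R.finsum_cong') (auto simp: Mat_simps R.l_distr)
    also have "\<dots> = (\<Oplus>\<^bsub>K\<^esub>p\<in>B \<times> B. coeffs s p \<otimes>\<^bsub>K\<^esub> \<phi> (case_prod AA.pure p))
        \<oplus>\<^bsub>K\<^esub> (\<Oplus>\<^bsub>K\<^esub>p\<in>B \<times> B. coeffs t p \<otimes>\<^bsub>K\<^esub> \<phi> (case_prod AA.pure p))"
      using add(1,2) gen by (intro R.finsum_addf) auto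
    finally show ?case using add assms(2) by simp
  next
    case (smult c t)
    have "(\<Oplus>\<^bsub>K\<^esub>p\<in>B \<times> B. coeffs (c \<odot>\<^bsub>AA.T\<^esub> t) p \<otimes>\<^bsub>K\<^esub> \<phi> (case_prod AA.pure p))
        = (\<Oplus>\<^bsub>K\<^esub>p\<in>B \<times> B. c \<otimes>\<^bsub>K\<^esub> (coeffs t p \<otimes>\<^bsub>K\<^esub> \<phi> (case_prod AA.pure p)))"
      using smult(1,2) gen by (intro R.finsum_cong') (auto simp: Mat_simps R.m_assoc)
    also have "\<dots> = c \<otimes>\<^bsub>K\<^esub> (\<Oplus>\<^bsub>K\<^esub>p\<in>B \<times> B. coeffs t p \<otimes>\<^bsub>K\<^esub> \<phi> (case_prod AA.pure p))"
      using smult(1,2) gen by (intro R.finsum_rdistr[symmetric]) auto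
    finally show ?case using smult assms(3) by simp
  next
    case (base b d)
    have delta: "coeffs (AA.pure b d) p = (if p = (b, d) then \<one>\<^bsub>K\<^esub> else \<zero>\<^bsub>K\<^esub>)" if "p \<in> B \<times> B" for p
      using that base B_closed by (auto simp: coeffs_pure coord_basis subset_iff split: if_splits)
    have "(\<Oplus>\<^bsub>K\<^esub>p\<in>B \<times> B. coeffs (AA.pure b d) p \<otimes>\<^bsub>K\<^esub> \<phi> (case_prod AA.pure p))
        = coeffs (AA.pure b d) (b, d) \<otimes>\<^bsub>K\<^esub> \<phi> (case_prod AA.pure (b, d))"
      using base gen by (intro R.finsum_single) (auto simp: delta)
    then show ?case using base gen by (simp add: delta)
  }
qed

lemma coeffs_left_act:
  assumes c: "c \<in> carrier A" and t: "t \<in> carrier AA.T" and b: "b \<in> B" and d: "d \<in> B"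
  shows "coeffs (left_act K A c t) (b, d) =
    (\<Oplus>\<^bsub>K\<^esub>p\<in>B \<times> B. coeffs t p \<otimes>\<^bsub>K\<^esub> (coord (c \<otimes>\<^bsub>A\<^esub> fst p) b \<otimes>\<^bsub>K\<^esub> coord (snd p) d))"
proof -
  interpret act: mod_hom K AA.T AA.T "left_act K A c"
    by (intro mod_hom.intro mod_hom_axioms.intro AA.T.module_axioms left_act_linear c)
  have "coeffs (left_act K A c t) (b, d) = (\<Oplus>\<^bsub>K\<^esub>p\<in>B \<times> B. coeffs t p \<otimes>\<^bsub>K\<^esub>
      coeffs (left_act K A c (case_prod AA.pure p)) (b, d))"
    using b d by (intro linear_functional_expansion t) (auto simp: Mat_simps)
  also have "\<dots> =
      (\<Oplus>\<^bsub>K\<^esub>p\<in>B \<times> B. coeffs t p \<otimes>\<^bsub>K\<^esub> (coord (c \<otimes>\<^bsub>A\<^esub> fst p) b \<otimes>\<^bsub>K\<^esub> coord (snd p) d))"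
    using B_closed b c d t
    by (intro R.finsum_cong') (auto simp: left_act_pure coeffs_pure subset_iff)
  finally show ?thesis .
qed

lemma coeffs_right_act:
  assumes c: "c \<in> carrier A" and t: "t \<in> carrier AA.T" and b: "b \<in> B" and d: "d \<in> B"
  shows "coeffs (right_act K A t c) (b, d) =
    (\<Oplus>\<^bsub>K\<^esub>p\<in>B \<times> B. coeffs t p \<otimes>\<^bsub>K\<^esub> (coord (fst p) b \<otimes>\<^bsub>K\<^esub> coord (snd p \<otimes>\<^bsub>A\<^esub> c) d))"
proof -
  interpret act: mod_hom K AA.T AA.T "\<lambda>t. right_act K A t c"
    by (intro mod_hom.intro mod_hom_axioms.intro AA.T.module_axioms right_act_linear c)
  have "coeffs (right_act K A t c) (b, d) = (\<Oplus>\<^bsub>K\<^esub>p\<in>B \<times> B. coeffs t p \<otimes>\<^bsub>K\<^esub>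
      coeffs (right_act K A (case_prod AA.pure p) c) (b, d))"
    using b d by (intro linear_functional_expansion t) (auto simp: Mat_simps)
  also have "\<dots> =
      (\<Oplus>\<^bsub>K\<^esub>p\<in>B \<times> B. coeffs t p \<otimes>\<^bsub>K\<^esub> (coord (fst p) b \<otimes>\<^bsub>K\<^esub> coord (snd p \<otimes>\<^bsub>A\<^esub> c) d))"
    using B_closed b c d t
    by (intro R.finsum_cong') (auto simp: right_act_pure coeffs_pure subset_iff)
  finally show ?thesis .
qed

section \<open>The Frobenius space\<close>

text \<open>
  The matrix form of \<open>(1 \<otimes> A + A \<otimes> 1) \<inter> {t. t Casimir} = 0\<close>. When \<open>X\<close>, the matrix of \<open>t\<close>,
  vanishes outside the row and the column of \<open>1\<close>, comparing the entries of \<open>c \<cdot> t\<close> and \<open>t \<cdot> c\<close> at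
  \<open>b, d \<noteq> 1\<close> gives \<open>\<delta>\<^sub>b(c) X(1, d) = \<delta>\<^sub>d(c) X(b, 1)\<close> for the coordinate functionals \<open>\<delta>\<close>. Two
  distinct basis elements other than \<open>1\<close> are needed to make one side vanish while the other keeps
  the coefficient \<open>1\<close>.
\<close>

lemma casimir_eq_zero:
  assumes one_B: "\<one>\<^bsub>A\<^esub> \<in> B" and card: "card B \<ge> 3"
    and t: "t \<in> carrier AA.T"
    and casimir: "\<And>c. c \<in> carrier A \<Longrightarrow> left_act K A c t = right_act K A t c"
    and zero: "\<And>b d. \<lbrakk>b \<in> B - {\<one>\<^bsub>A\<^esub>}; d \<in> B - {\<one>\<^bsub>A\<^esub>}\<rbrakk> \<Longrightarrow> coeffs t (b, d) = \<zero>\<^bsub>K\<^esub>"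
  shows "t = \<zero>\<^bsub>AA.T\<^esub>"
proof -
  let ?J = "B - {\<one>\<^bsub>A\<^esub>}"
  have mem: "b \<in> carrier A" if "b \<in> B" for b using that B_closed by blast
  \<comment> \<open>Within a column that is zero off the row of \<open>1\<close>, the sum for \<open>c \<cdot> t\<close> collapses to the
    single term with \<open>c * 1 = c\<close>. The next fact is the mirror image for \<open>t \<cdot> c\<close>.\<close>
  have left: "coeffs (left_act K A c t) (b, d) = coord c b \<otimes>\<^bsub>K\<^esub> coeffs t (\<one>\<^bsub>A\<^esub>, d)"
    if c: "c \<in> carrier A" and b: "b \<in> B" and d: "d \<in> B"
      and column0: "\<And>e. e \<in> ?J \<Longrightarrow> coeffs t (e, d) = \<zero>\<^bsub>K\<^esub>" for b c d
  proof -
    have off: "coeffs t p \<otimes>\<^bsub>K\<^esub> (coord (c \<otimes>\<^bsub>A\<^esub> fst p) b \<otimes>\<^bsub>K\<^esub> coord (snd p) d) = \<zero>\<^bsub>K\<^esub>"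
      if p: "p \<in> B \<times> B" "p \<noteq> (\<one>\<^bsub>A\<^esub>, d)" for p
    proof (cases "snd p = d")
      case True
      then have "coeffs t p = \<zero>\<^bsub>K\<^esub>" using column0[of "fst p"] p by (cases p) auto
      then show ?thesis using p mem c b d by auto
    next
      case False
      then have "coord (snd p) d = \<zero>\<^bsub>K\<^esub>" using p b d by (auto simp: coord_basis)
      then show ?thesis using p mem c b d t by auto
    qed
    have "coeffs (left_act K A c t) (b, d) = coeffs t (\<one>\<^bsub>A\<^esub>, d) \<otimes>\<^bsub>K\<^esub>
        (coord (c \<otimes>\<^bsub>A\<^esub> fst (\<one>\<^bsub>A\<^esub>, d)) b \<otimes>\<^bsub>K\<^esub> coord (snd (\<one>\<^bsub>A\<^esub>, d)) d)"
      unfolding coeffs_left_act[OF c t b d]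
      using mem c b d t one_B finite_B by (intro R.finsum_single off) auto
    then show ?thesis using c b d t one_B by (simp add: coord_basis R.m_comm)
  qed
  have right: "coeffs (right_act K A t c) (b, d) = coord c d \<otimes>\<^bsub>K\<^esub> coeffs t (b, \<one>\<^bsub>A\<^esub>)"
    if c: "c \<in> carrier A" and b: "b \<in> B" and d: "d \<in> B"
      and row0: "\<And>e. e \<in> ?J \<Longrightarrow> coeffs t (b, e) = \<zero>\<^bsub>K\<^esub>" for b c d
  proof -
    have off: "coeffs t p \<otimes>\<^bsub>K\<^esub> (coord (fst p) b \<otimes>\<^bsub>K\<^esub> coord (snd p \<otimes>\<^bsub>A\<^esub> c) d) = \<zero>\<^bsub>K\<^esub>"
      if p: "p \<in> B \<times> B" "p \<noteq> (b, \<one>\<^bsub>A\<^esub>)" for p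
    proof (cases "fst p = b")
      case True
      then have "coeffs t p = \<zero>\<^bsub>K\<^esub>" using row0[of "snd p"] p by (cases p) auto
      then show ?thesis using p mem c b d by auto
    next
      case False
      then have "coord (fst p) b = \<zero>\<^bsub>K\<^esub>" using p b d by (auto simp: coord_basis)
      then show ?thesis using p mem c b d t by auto
    qed
    have "coeffs (right_act K A t c) (b, d) = coeffs t (b, \<one>\<^bsub>A\<^esub>) \<otimes>\<^bsub>K\<^esub>
        (coord (fst (b, \<one>\<^bsub>A\<^esub>)) b \<otimes>\<^bsub>K\<^esub> coord (snd (b, \<one>\<^bsub>A\<^esub>) \<otimes>\<^bsub>A\<^esub> c) d)"
      unfolding coeffs_right_act[OF c t b d]
      using mem c b d t one_B finite_B by (intro R.finsum_single off) auto
    then show ?thesis using c b d t one_B by (simp add: coord_basis R.m_comm)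
  qed
  have other: "\<exists>d\<in>?J. d \<noteq> b" for b
  proof (rule ccontr)
    assume "\<not> (\<exists>d\<in>?J. d \<noteq> b)"
    then have "B \<subseteq> {\<one>\<^bsub>A\<^esub>, b}" by blast
    then have "card B \<le> card {\<one>\<^bsub>A\<^esub>, b}" by (intro card_mono) auto
    also have "\<dots> \<le> 2" by (simp add: card_insert_if)
    finally show False using card by simp
  qed
  have swap: "coord c b \<otimes>\<^bsub>K\<^esub> coeffs t (\<one>\<^bsub>A\<^esub>, d) = coord c d \<otimes>\<^bsub>K\<^esub> coeffs t (b, \<one>\<^bsub>A\<^esub>)"
    if "b \<in> ?J" "d \<in> ?J" "c \<in> B" for b c d
    using that mem left[of c b d] right[of c b d] casimir[of c] zero by simp
  have row: "coeffs t (\<one>\<^bsub>A\<^esub>, d) = \<zero>\<^bsub>K\<^esub>" if d: "d \<in> ?J" for d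
  proof -
    obtain b where b: "b \<in> ?J" "b \<noteq> d" using other by blast
    show ?thesis using swap[of b d b] b d t one_B by (simp add: coord_basis)
  qed
  have column: "coeffs t (b, \<one>\<^bsub>A\<^esub>) = \<zero>\<^bsub>K\<^esub>" if b: "b \<in> ?J" for b
  proof -
    obtain d where d: "d \<in> ?J" "d \<noteq> b" using other by blast
    show ?thesis using swap[of b d d] b d t one_B by (simp add: coord_basis)
  qed
  \<comment> \<open>The row of \<open>1\<close> is now known to vanish off the corner, so the entry \<open>(1, c)\<close> of \<open>t \<cdot> c\<close>
    isolates the corner, while that of \<open>c \<cdot> t\<close> is a multiple of \<open>X(1, c) = 0\<close>.\<close>
  have corner: "coeffs t (\<one>\<^bsub>A\<^esub>, \<one>\<^bsub>A\<^esub>) = \<zero>\<^bsub>K\<^esub>"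
  proof -
    obtain c where c: "c \<in> ?J" using other by blast
    have "coeffs (left_act K A c t) (\<one>\<^bsub>A\<^esub>, c) = coord c \<one>\<^bsub>A\<^esub> \<otimes>\<^bsub>K\<^esub> coeffs t (\<one>\<^bsub>A\<^esub>, c)"
      using c by (intro left mem one_B zero) auto
    moreover have "coeffs (right_act K A t c) (\<one>\<^bsub>A\<^esub>, c) = coord c c \<otimes>\<^bsub>K\<^esub> coeffs t (\<one>\<^bsub>A\<^esub>, \<one>\<^bsub>A\<^esub>)"
      using c by (intro right mem one_B row) auto
    ultimately have "coord c \<one>\<^bsub>A\<^esub> \<otimes>\<^bsub>K\<^esub> coeffs t (\<one>\<^bsub>A\<^esub>, c)
        = coord c c \<otimes>\<^bsub>K\<^esub> coeffs t (\<one>\<^bsub>A\<^esub>, \<one>\<^bsub>A\<^esub>)"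
      using c mem casimir[of c] by simp
    then show ?thesis using c t one_B row[OF c] by (simp add: coord_basis)
  qed
  show ?thesis
    using zero row column corner by (intro coeffs_eq_zero[OF t]) blast
qed

text \<open>
  The injection takes a coproduct to the matrix of its value at \<open>1\<close> without the row and the column
  of \<open>1\<close>.
\<close>

lemma Frobdim_le:
  assumes one_B: "\<one>\<^bsub>A\<^esub> \<in> B" and card: "card B \<ge> 3"
  shows "vectorspace.fin_dim K (frobenius_space K A)" "Frobdim K A \<le> (card B - 1)\<^sup>2"
proof -
  let ?E = "frobenius_space K A" and ?J = "B - {\<one>\<^bsub>A\<^esub>}"
  let ?W = "free_module K (?J \<times> ?J)"
  let ?f = "\<lambda>D. restrict (coeffs (D \<one>\<^bsub>A\<^esub>)) (?J \<times> ?J)"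
  have J: "finite (?J \<times> ?J)" using finite_B by simp
  note W = free_module_vectorspace[OF field_axioms J] free_module_fin_dim[OF field_axioms J]
    free_module_dim_le[OF field_axioms J]
  have E_simps: "carrier ?E = nearly_frobenius_coproducts K A"
    "\<zero>\<^bsub>?E\<^esub> = (\<lambda>a\<in>carrier A. \<zero>\<^bsub>AA.T\<^esub>)"
    "D \<oplus>\<^bsub>?E\<^esub> D' = (\<lambda>a\<in>carrier A. D a \<oplus>\<^bsub>AA.T\<^esub> D' a)"
    "k \<odot>\<^bsub>?E\<^esub> D = (\<lambda>a\<in>carrier A. k \<odot>\<^bsub>AA.T\<^esub> D a)" for D D' k
    by (simp_all add: frobenius_space_def Let_def)
  have W_simps: "carrier ?W = ?J \<times> ?J \<rightarrow>\<^sub>E carrier K"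
    "u \<oplus>\<^bsub>?W\<^esub> v = (\<lambda>p\<in>?J \<times> ?J. u p \<oplus>\<^bsub>K\<^esub> v p)"
    "k \<odot>\<^bsub>?W\<^esub> u = (\<lambda>p\<in>?J \<times> ?J. k \<otimes>\<^bsub>K\<^esub> u p)"
    "\<zero>\<^bsub>?W\<^esub> = (\<lambda>p\<in>?J \<times> ?J. \<zero>\<^bsub>K\<^esub>)" for u v k
    using J by (auto simp: free_module_simps[OF R.is_cring] free_module_zero[OF R.is_cring])
  have hom: "?f \<in> module_hom K ?E ?W"
    by (auto simp: module_hom_def E_simps W_simps coproduct_closed Mat_simps
        split: if_splits intro!: restrict_ext)
  interpret f: linear_map K ?E ?W ?f
    using frobenius_space_vectorspace W(1) hom
    by (intro linear_map.intro mod_hom.intro mod_hom_axioms.intro) (auto simp: vectorspace_def)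
  \<comment> \<open>The kernel is trivial: \<open>D 1\<close> is a Casimir tensor whose matrix vanishes off the row and the
    column of \<open>1\<close>.\<close>
  have "D = \<zero>\<^bsub>?E\<^esub>" if D: "D \<in> carrier ?E" and fD: "?f D = \<zero>\<^bsub>?W\<^esub>" for D
  proof -
    have D': "D \<in> nearly_frobenius_coproducts K A" using D by (simp add: E_simps)
    have left: "D (a \<otimes>\<^bsub>A\<^esub> x) = left_act K A a (D x)"
      and right: "D (x \<otimes>\<^bsub>A\<^esub> a) = right_act K A (D x) a" if "a \<in> carrier A" "x \<in> carrier A" for a x
      using D' that by (auto simp: nearly_frobenius_coproducts_def)
    have "coeffs (D \<one>\<^bsub>A\<^esub>) (b, d) = \<zero>\<^bsub>K\<^esub>" if "b \<in> ?J" "d \<in> ?J" for b d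
      using fun_cong[OF fD, of "(b, d)"] that by (simp add: W_simps)
    moreover have "left_act K A a (D \<one>\<^bsub>A\<^esub>) = right_act K A (D \<one>\<^bsub>A\<^esub>) a" if "a \<in> carrier A" for a
      using left[of a "\<one>\<^bsub>A\<^esub>"] right[of a "\<one>\<^bsub>A\<^esub>"] that by simp
    ultimately have "D \<one>\<^bsub>A\<^esub> = \<zero>\<^bsub>AA.T\<^esub>"
      by (intro casimir_eq_zero one_B card coproduct_closed[OF D']) auto
    moreover have "left_act K A a \<zero>\<^bsub>AA.T\<^esub> = \<zero>\<^bsub>AA.T\<^esub>" if a: "a \<in> carrier A" for a
      using mod_hom.f0_is_0[OF mod_hom.intro, OF AA.T.module_axioms AA.T.module_axioms
        mod_hom_axioms.intro, OF left_act_linear[OF a]] .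
    ultimately have "D a = \<zero>\<^bsub>AA.T\<^esub>" if "a \<in> carrier A" for a
      using left[of a "\<one>\<^bsub>A\<^esub>"] that by simp
    then show ?thesis
      using D' by (intro extensionalityI[of D "carrier A"])
        (auto simp: E_simps nearly_frobenius_coproducts_def)
  qed
  then have "carrier (f.V.vs f.kerT) = {\<zero>\<^bsub>?E\<^esub>}"
    by (auto simp: f.mod_hom.ker_def)
  then have inj: "inj_on ?f (carrier ?E)" by (rule f.Ke0_imp_inj)
  show "vectorspace.fin_dim K ?E" by (rule f.inj_dim_le(1)[OF inj W(2)])
  have "Frobdim K A \<le> vectorspace.dim K ?W"
    unfolding Frobdim_def by (rule f.inj_dim_le(2)[OF inj W(2)])
  also have "\<dots> \<le> card (?J \<times> ?J)" by (rule W(3))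
  also have "\<dots> = (card B - 1)\<^sup>2"
    using one_B finite_B by (simp add: power2_eq_square card_cartesian_product)
  finally show "Frobdim K A \<le> (card B - 1)\<^sup>2" .
qed

end

text \<open>
  Positive dimension excludes the zero algebra, in which \<open>1 = 0\<close> is not independent. Otherwise
  the exchange theorem completes \<open>1\<close> to a generating set no larger than a given basis.
\<close>

lemma (in unital_algebra) unital_basis_exists:
  assumes fd: "fin_dim" and nontrivial: "dim > 0"
  obtains B where "finite B" "basis B" "\<one>\<^bsub>A\<^esub> \<in> B"
proof -
  obtain C where C: "finite C" "basis C" using finite_basis_exists[OF fd] by blast
  have "\<one>\<^bsub>A\<^esub> \<noteq> \<zero>\<^bsub>A\<^esub>"
  proof
    assume "\<one>\<^bsub>A\<^esub> = \<zero>\<^bsub>A\<^esub>"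
    then have "carrier A = {\<zero>\<^bsub>A\<^esub>}" using A.one_zeroD by simp
    then have "gen_set {}" by (simp add: span_empty)
    then show False using gen_ge_dim[of "{}"] nontrivial by simp
  qed
  then have li: "lin_indpt {\<one>\<^bsub>A\<^esub>}"
    using lin_dep_iff_in_span[of "{}" "\<one>\<^bsub>A\<^esub>"] by (simp add: span_empty lin_dep_def)
  obtain C' where C': "finite C'" "C' \<subseteq> carrier A" "int (card C') \<le> int (card C) - int (card {\<one>\<^bsub>A\<^esub>})"
    "span ({\<one>\<^bsub>A\<^esub>} \<union> C') = span C"
    using replacement[of "{\<one>\<^bsub>A\<^esub>}" C] C li by (auto simp: basis_def)
  have "card ({\<one>\<^bsub>A\<^esub>} \<union> C') \<le> dim"
    using C' dim_basis[OF C] by (simp add: card_insert_if)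
  then have "basis ({\<one>\<^bsub>A\<^esub>} \<union> C')"
    using C C' by (intro dim_gen_is_basis) (auto simp: basis_def)
  then show thesis using C'(1) by (intro that[of "{\<one>\<^bsub>A\<^esub>} \<union> C'"]) auto
qed

theorem theorem1:
  fixes K :: "('k, 'r) ring_scheme"
    and A :: "('k, 'a, 'm) module_scheme"
    and n :: nat
  assumes "unital_algebra K A"
    and "vectorspace.fin_dim K A"
    and "vectorspace.dim K A = n"
    and "n \<ge> 3"
  shows "vectorspace.fin_dim K (frobenius_space K A) \<and> Frobdim K A \<le> (n - 1)\<^sup>2"
proof -
  interpret unital_algebra K A by fact
  obtain B where B: "finite B" "basis B" "\<one>\<^bsub>A\<^esub> \<in> B"
    using unital_basis_exists assms by auto
  interpret algebra_basis K A B
    by (intro algebra_basis.intro unital_algebra_axioms finite_basis.intro vectorspace_axioms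
      finite_basis_axioms.intro B)
  have "card B = n" using dim_basis[OF B(1,2)] assms(3) by simp
  then show ?thesis using Frobdim_le[OF B(3)] assms(4) by simp
qed

end
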